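(* Let $M$ be a compact surface with $\chi(M)<0$ and let $\mathfrak{T}$ be a triangular decomposition of $M$. Let $p\in(0,\pi)^{E-\partial E}\times\left(0,\frac{\pi}{2}\right)^{\partial E}\subset\mathbb{R}^E$, with coordinates $\psi^e(p)$, satisfy the following two conditions. (i) $\sum_{e\in v}\psi^e(p)=2\pi$ for every $v\in V-\partial V$, and $\sum_{e\in v}\psi^e(p)=\pi$ for every $v\in\partial V$. (ii) For every nonempty set $S$ of triangles of $\mathfrak{T}$, consisting of $|S|$ triangles, $\sum_{e\in S}\theta^e(p)>\pi|S|$, the sum being over the set of edges of $\mathfrak{T}$ belonging to some triangle of $S$. Then $p$ is an ideal disk pattern, i.e. there is a uniform angle system $u$ with $\Psi(u)=p$.
   Context: $M$ is a compact two-dimensional surface, possibly with boundary, with $\chi(M)<0$. A triangular decomposition $\mathfrak{T}$ of $M$ is a cell decomposition of $M$ that lifts to a triangulation of the universal cover of $M$. $V,E,F$ denote the sets of vertices, edges and triangles of $\mathfrak{T}$ (and also their cardinalities), and $\partial V,\partial E$ the sets of boundary vertices and boundary edges. Incidences of triangles, edges and corners are counted as in the universal cover (with multiplicity); in particular $\sum_{e\in v}$ is the sum over edges at $v$ counted as in the universal cover. Each $e\in E-\partial E$ has two sides, occupied by triangles $t_1,t_2$. The $3F$ corners (angle slots) $\alpha_i$ of the triangles are taken as the basis of $\mathbb{R}^{3F}$, with dual basis $\alpha^i$; $\alpha^i(x)$ is the angle which $x$ assigns to slot $\alpha_i$. For a triangle $t$, $d^t(x)$ is the unordered triple of the angles assigned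 by $x$ to the slots of $t$, $\sigma^t(x)$ is their sum, and $k^t(x)=\sigma^t(x)-\pi$. For a vertex $v$, $p^v(x)$ is the sum of the angles of $x$ over all slots at $v$. Put $$\mathfrak{V}=\{x\in\mathbb{R}^{3F}: p^v(x)=2\pi \text{ for } v\in V-\partial V,\ p^v(x)=\pi\text{ for } v\in\partial V\},$$ $$\mathfrak{N}=\{x\in\mathfrak{V}: k^t(x)<0 \text{ for all } t,\ \alpha^i(x)\in(0,\pi)\text{ for all } i\}.$$ Points of $\mathfrak{N}$ are called angle systems. For $x\in\mathfrak{N}$ each triangle $t$ is realized by a hyperbolic triangle with angles $d^t(x)$; for an edge $e$ of $t$ let $l^e_t(x)$ be the hyperbolic length of $e$ in this realization. An angle system $u$ is uniform if all the hyperbolic realizations of the triangles fit together to form a hyperbolic structure on $M$, i.e. $l^e_{t_1}(u)=l^e_{t_2}(u)$ for every $e\in E-\partial E$ with triangles $t_1,t_2$ on its two sides. For an edge $e$ of a triangle $t$, $\psi^e_t(x)=\frac{B+C-A}{2}$ where $A$ is the angle of $x$ at the slot of $t$ opposite $e$ and $B,C$ are the angles at the two slots of $t$ adjacent to $e$. Put $\psi^e=\psi^e_{t_1}+\psi^e_{t_2}$ for $e\in E-\partial E$ and $\psi^e=\psi^e_t$ for $e\in\partial E$ contained in $t$. $\mathbb{R}^E$ has a basis $\psi_e$ indexed by edges, with dual basis also denoted $\psi^e$, and $\Psi:\mathbb{R}^{3F}\to\mathbb{R}^E$ is $\Psi(x)=\sum_e\psi^e(x)\psi_e$. For $p\in\mathbb{R}^E$,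 $\theta^e(p)=\pi-\psi^e(p)$ if $e\in E-\partial E$ and $\theta^e(p)=\frac{\pi}{2}-\psi^e(p)$ if $e\in\partial E$. *)

theory Defs
  imports "HOL-Analysis.Analysis"
begin

section \<open>Compact surfaces and their universal covers\<close>

definition surface_interior :: "'m::t2_space set \<Rightarrow> 'm set" where
  "surface_interior M =
     {x \<in> M. \<exists>W. openin (top_of_set M) W \<and> x \<in> W \<and> W homeomorphic (UNIV :: complex set)}"

definition surface_boundary :: "'m::t2_space set \<Rightarrow> 'm set" where
  "surface_boundary M = M - surface_interior M"

definition compact_surface :: "'m::t2_space set \<Rightarrow> bool" where
  "compact_surface M \<longleftrightarrow> compact M \<and> connected M \<and>
     (\<forall>x\<in>M. \<exists>W. openin (top_of_set M) W \<and> x \<in> W \<and>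
        (W homeomorphic (UNIV :: complex set) \<or> W homeomorphic {z :: complex. 0 \<le> Im z}))"

definition universal_cover ::
  "'u::topological_space set \<Rightarrow> ('u \<Rightarrow> 'm) \<Rightarrow> 'm::t2_space set \<Rightarrow> bool" where
  "universal_cover U q M \<longleftrightarrow> covering_space U q M \<and> simply_connected U"


section \<open>Triangular decompositions\<close>

text \<open>
  The standard 2-simplex has its corners indexed by the cyclic type \<^typ>\<open>3\<close>; the side with
  index \<open>i\<close> is opposite to the corner \<open>i\<close> and joins the corners \<open>i + 1\<close> and \<open>i + 2\<close>.
\<close>

definition std_simplex :: "(real ^ 3) set" where
  "std_simplex = {x. (\<forall>i. 0 \<le> x $ i) \<and> (\<Sum>i\<in>UNIV. x $ i) = 1}"

definition corner :: "3 \<Rightarrow> real ^ 3" where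
  "corner i = axis i 1"

definition open_triangle :: "(real ^ 3) set" where
  "open_triangle = {x \<in> std_simplex. \<forall>i. 0 < x $ i}"

definition open_side :: "3 \<Rightarrow> (real ^ 3) set" where
  "open_side i = {x \<in> std_simplex. x $ i = 0 \<and> (\<forall>j. j \<noteq> i \<longrightarrow> 0 < x $ j)}"

definition face :: "3 set \<Rightarrow> (real ^ 3) set" where
  "face I = {x \<in> std_simplex. \<forall>i. i \<notin> I \<longrightarrow> x $ i = 0}"

text \<open>
  A decomposition is given by a finite index set \<open>T\<close> of triangles and, for every triangle
  \<open>t\<close>, a characteristic map \<open>\<phi> t\<close> from the standard simplex to \<open>M\<close>. A slot \<open>(t, i)\<close> stands for
  the corner \<open>i\<close> of \<open>t\<close> and also for the side of \<open>t\<close> opposite to this corner. Vertices are points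
  of \<open>M\<close>, and edges are open 1-cells of \<open>M\<close>; different slots of one triangle may define the same
  vertex or the same edge.
\<close>

definition slots :: "'t set \<Rightarrow> ('t \<times> 3) set" where
  "slots T = T \<times> UNIV"

definition vertex_at :: "('t \<Rightarrow> real ^ 3 \<Rightarrow> 'm) \<Rightarrow> 't \<times> 3 \<Rightarrow> 'm" where
  "vertex_at \<phi> s = \<phi> (fst s) (corner (snd s))"

definition edge_at :: "('t \<Rightarrow> real ^ 3 \<Rightarrow> 'm) \<Rightarrow> 't \<times> 3 \<Rightarrow> 'm set" where
  "edge_at \<phi> s = \<phi> (fst s) ` open_side (snd s)"

definition vertices :: "'t set \<Rightarrow> ('t \<Rightarrow> real ^ 3 \<Rightarrow> 'm) \<Rightarrow> 'm set" where
  "vertices T \<phi> = vertex_at \<phi> ` slots T"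

definition edges :: "'t set \<Rightarrow> ('t \<Rightarrow> real ^ 3 \<Rightarrow> 'm) \<Rightarrow> 'm set set" where
  "edges T \<phi> = edge_at \<phi> ` slots T"

definition boundary_vertices ::
  "'m::t2_space set \<Rightarrow> 't set \<Rightarrow> ('t \<Rightarrow> real ^ 3 \<Rightarrow> 'm) \<Rightarrow> 'm set" where
  "boundary_vertices M T \<phi> = {v \<in> vertices T \<phi>. v \<in> surface_boundary M}"

definition boundary_edges ::
  "'m::t2_space set \<Rightarrow> 't set \<Rightarrow> ('t \<Rightarrow> real ^ 3 \<Rightarrow> 'm) \<Rightarrow> 'm set set" where
  "boundary_edges M T \<phi> = {e \<in> edges T \<phi>. e \<subseteq> surface_boundary M}"

definition sides_of :: "'t set \<Rightarrow> ('t \<Rightarrow> real ^ 3 \<Rightarrow> 'm) \<Rightarrow> 'm set \<Rightarrow> ('t \<times> 3) set" where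
  "sides_of T \<phi> e = {s \<in> slots T. edge_at \<phi> s = e}"

text \<open>
  The fourth to sixth conditions say that \<open>M\<close> is partitioned into vertices, open edges and open
  triangles, the characteristic maps being injective on open cells. The last condition holds for
  every such decomposition of a surface; it is recorded here because the notions below
  refer to the one or two sides of an edge.
\<close>

definition cell_decomposition ::
  "'m::t2_space set \<Rightarrow> 't set \<Rightarrow> ('t \<Rightarrow> real ^ 3 \<Rightarrow> 'm) \<Rightarrow> bool" where
  "cell_decomposition M T \<phi> \<longleftrightarrow>
     finite T \<and>
     (\<forall>t\<in>T. continuous_on std_simplex (\<phi> t)) \<and>
     (\<Union>t\<in>T. \<phi> t ` std_simplex) = M \<and>
     (\<forall>t\<in>T. \<forall>i. inj_on (\<phi> t) (open_side i)) \<and>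
     (\<forall>t\<in>T. \<forall>t'\<in>T. \<forall>x\<in>open_triangle. \<forall>y\<in>std_simplex. \<phi> t x = \<phi> t' y \<longrightarrow> t = t' \<and> x = y) \<and>
     (\<forall>t\<in>T. \<forall>t'\<in>T. \<forall>i. \<forall>x\<in>open_side i. \<forall>y\<in>std_simplex. \<phi> t x = \<phi> t' y \<longrightarrow>
        (\<exists>j. y \<in> open_side j \<and> edge_at \<phi> (t, i) = edge_at \<phi> (t', j))) \<and>
     (\<forall>e\<in>edges T \<phi>. card (sides_of T \<phi> e) = (if e \<in> boundary_edges M T \<phi> then 1 else 2))"

text \<open>
  The cells of the lifted decomposition are the images of all lifts of the characteristic maps.
  They form a triangulation if all closed triangles are embedded and any two of them are either
  equal or meet in a common proper face (possibly empty).
\<close>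

definition lifts_of ::
  "'u::topological_space set \<Rightarrow> ('u \<Rightarrow> 'm) \<Rightarrow> 't set \<Rightarrow> ('t \<Rightarrow> real ^ 3 \<Rightarrow> 'm)
     \<Rightarrow> (real ^ 3 \<Rightarrow> 'u) set" where
  "lifts_of U q T \<phi> = {f. continuous_on std_simplex f \<and> f ` std_simplex \<subseteq> U \<and>
     (\<exists>t\<in>T. \<forall>x\<in>std_simplex. q (f x) = \<phi> t x)}"

definition lifts_to_triangulation ::
  "'u::topological_space set \<Rightarrow> ('u \<Rightarrow> 'm) \<Rightarrow> 't set \<Rightarrow> ('t \<Rightarrow> real ^ 3 \<Rightarrow> 'm) \<Rightarrow> bool" where
  "lifts_to_triangulation U q T \<phi> \<longleftrightarrow>
     (\<forall>f\<in>lifts_of U q T \<phi>. inj_on f std_simplex) \<and>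
     (\<forall>f\<in>lifts_of U q T \<phi>. \<forall>g\<in>lifts_of U q T \<phi>. f ` std_simplex \<noteq> g ` std_simplex \<longrightarrow>
        (\<exists>I J. I \<noteq> UNIV \<and> J \<noteq> UNIV \<and>
           f ` std_simplex \<inter> g ` std_simplex = f ` face I \<and> f ` face I = g ` face J))"

definition triangular_decomposition ::
  "'m::t2_space set \<Rightarrow> 'u::topological_space set \<Rightarrow> ('u \<Rightarrow> 'm)
     \<Rightarrow> 't set \<Rightarrow> ('t \<Rightarrow> real ^ 3 \<Rightarrow> 'm) \<Rightarrow> bool" where
  "triangular_decomposition M U q T \<phi> \<longleftrightarrow>
     cell_decomposition M T \<phi> \<and> universal_cover U q M \<and> lifts_to_triangulation U q T \<phi>"

definition euler_characteristic :: "'t set \<Rightarrow> ('t \<Rightarrow> real ^ 3 \<Rightarrow> 'm) \<Rightarrow> int" where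
  "euler_characteristic T \<phi> =
     int (card (vertices T \<phi>)) - int (card (edges T \<phi>)) + int (card T)"

text \<open>
  The multiplicity of an edge at a vertex, as seen in the universal cover, is the number of
  ends of the edge at this vertex. An edge whose closure adds a single point is a loop and has
  both of its ends there.
\<close>

definition endpoints :: "'m::t2_space set \<Rightarrow> 'm set" where
  "endpoints e = closure e - e"

definition end_mult :: "'m::t2_space \<Rightarrow> 'm set \<Rightarrow> nat" where
  "end_mult v e = (if v \<notin> endpoints e then 0 else if endpoints e = {v} then 2 else 1)"


section \<open>Hyperbolic triangles\<close>

text \<open>
  The hyperboloid model: the sheet \<open>\<langle>X, X\<rangle> = -1\<close>, \<open>snd X > 0\<close> in Minkowski 3-space
  \<^typ>\<open>complex \<times> real\<close>, with \<open>cosh (dist X Y) = - \<langle>X, Y\<rangle>\<close>.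
\<close>

definition lorentz :: "complex \<times> real \<Rightarrow> complex \<times> real \<Rightarrow> real" where
  "lorentz X Y = fst X \<bullet> fst Y - snd X * snd Y"

definition hyperbolic_plane :: "(complex \<times> real) set" where
  "hyperbolic_plane = {X. lorentz X X = -1 \<and> 0 < snd X}"

definition hyp_dist :: "complex \<times> real \<Rightarrow> complex \<times> real \<Rightarrow> real" where
  "hyp_dist X Y = arcosh (- lorentz X Y)"

text \<open>
  The orthogonal projection of \<open>Y\<close> to the tangent plane at \<open>X\<close>, which is an initial direction of
  the geodesic from \<open>X\<close> to \<open>Y\<close>. The Lorentz form is positive definite on the tangent plane.
\<close>

definition hyp_direction :: "complex \<times> real \<Rightarrow> complex \<times> real \<Rightarrow> complex \<times> real" where
  "hyp_direction X Y = Y + lorentz X Y *\<^sub>R X"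

definition hyp_angle :: "complex \<times> real \<Rightarrow> complex \<times> real \<Rightarrow> complex \<times> real \<Rightarrow> real" where
  "hyp_angle X Y Z = (let a = hyp_direction X Y; b = hyp_direction X Z in
     arccos (lorentz a b / (sqrt (lorentz a a) * sqrt (lorentz b b))))"

definition hyp_realization ::
  "real \<Rightarrow> real \<Rightarrow> real \<Rightarrow> complex \<times> real \<Rightarrow> complex \<times> real \<Rightarrow> complex \<times> real \<Rightarrow> bool" where
  "hyp_realization A B C X Y Z \<longleftrightarrow>
     X \<in> hyperbolic_plane \<and> Y \<in> hyperbolic_plane \<and> Z \<in> hyperbolic_plane \<and>
     X \<noteq> Y \<and> Y \<noteq> Z \<and> Z \<noteq> X \<and>
     hyp_angle X Y Z = A \<and> hyp_angle Y Z X = B \<and> hyp_angle Z X Y = C"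

text \<open>
  The length of the side opposite to the angle \<open>A\<close>. It is well defined for
  \<open>A, B, C > 0\<close> with \<open>A + B + C < \<pi>\<close>, where a realization exists and is unique up to isometry.
\<close>

definition hyp_side_length :: "real \<Rightarrow> real \<Rightarrow> real \<Rightarrow> real" where
  "hyp_side_length A B C = (THE l. \<exists>X Y Z. hyp_realization A B C X Y Z \<and> l = hyp_dist Y Z)"


section \<open>Angle systems\<close>

text \<open>
  A point of \<open>\<real>\<^sup>3\<^sup>F\<close> is a function on slots, and a point of \<open>\<real>\<^sup>E\<close> is a function on edges; only the
  values on \<^term>\<open>slots T\<close> and \<^term>\<open>edges T \<phi>\<close> matter.
\<close>

definition vertex_angle_sum ::
  "'t set \<Rightarrow> ('t \<Rightarrow> real ^ 3 \<Rightarrow> 'm) \<Rightarrow> 'm \<Rightarrow> ('t \<times> 3 \<Rightarrow> real) \<Rightarrow> real" where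
  "vertex_angle_sum T \<phi> v x = (\<Sum>s\<in>{s \<in> slots T. vertex_at \<phi> s = v}. x s)"

definition triangle_angle_sum :: "'t \<Rightarrow> ('t \<times> 3 \<Rightarrow> real) \<Rightarrow> real" where
  "triangle_angle_sum t x = (\<Sum>i\<in>UNIV. x (t, i))"

definition triangle_curvature :: "'t \<Rightarrow> ('t \<times> 3 \<Rightarrow> real) \<Rightarrow> real" where
  "triangle_curvature t x = triangle_angle_sum t x - pi"

definition vertex_flat_systems ::
  "'m::t2_space set \<Rightarrow> 't set \<Rightarrow> ('t \<Rightarrow> real ^ 3 \<Rightarrow> 'm) \<Rightarrow> ('t \<times> 3 \<Rightarrow> real) set" where
  "vertex_flat_systems M T \<phi> =
     {x. (\<forall>v\<in>vertices T \<phi> - boundary_vertices M T \<phi>. vertex_angle_sum T \<phi> v x = 2 * pi) \<and>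
         (\<forall>v\<in>boundary_vertices M T \<phi>. vertex_angle_sum T \<phi> v x = pi)}"

definition angle_systems ::
  "'m::t2_space set \<Rightarrow> 't set \<Rightarrow> ('t \<Rightarrow> real ^ 3 \<Rightarrow> 'm) \<Rightarrow> ('t \<times> 3 \<Rightarrow> real) set" where
  "angle_systems M T \<phi> =
     {x \<in> vertex_flat_systems M T \<phi>.
        (\<forall>t\<in>T. triangle_curvature t x < 0) \<and> (\<forall>s\<in>slots T. 0 < x s \<and> x s < pi)}"

definition side_length :: "('t \<times> 3 \<Rightarrow> real) \<Rightarrow> 't \<times> 3 \<Rightarrow> real" where
  "side_length x s = (case s of (t, i) \<Rightarrow> hyp_side_length (x (t, i)) (x (t, i + 1)) (x (t, i + 2)))"

definition uniform ::
  "'m::t2_space set \<Rightarrow> 't set \<Rightarrow> ('t \<Rightarrow> real ^ 3 \<Rightarrow> 'm) \<Rightarrow> ('t \<times> 3 \<Rightarrow> real) \<Rightarrow> bool" where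
  "uniform M T \<phi> u \<longleftrightarrow> u \<in> angle_systems M T \<phi> \<and>
     (\<forall>e\<in>edges T \<phi> - boundary_edges M T \<phi>. \<forall>s\<in>sides_of T \<phi> e. \<forall>s'\<in>sides_of T \<phi> e.
        side_length u s = side_length u s')"

definition side_psi :: "('t \<times> 3 \<Rightarrow> real) \<Rightarrow> 't \<times> 3 \<Rightarrow> real" where
  "side_psi x s = (case s of (t, i) \<Rightarrow> (x (t, i + 1) + x (t, i + 2) - x (t, i)) / 2)"

definition Psi ::
  "'t set \<Rightarrow> ('t \<Rightarrow> real ^ 3 \<Rightarrow> 'm) \<Rightarrow> ('t \<times> 3 \<Rightarrow> real) \<Rightarrow> 'm set \<Rightarrow> real" where
  "Psi T \<phi> x e = (\<Sum>s\<in>sides_of T \<phi> e. side_psi x s)"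

definition theta ::
  "'m::t2_space set \<Rightarrow> 't set \<Rightarrow> ('t \<Rightarrow> real ^ 3 \<Rightarrow> 'm) \<Rightarrow> ('m set \<Rightarrow> real) \<Rightarrow> 'm set \<Rightarrow> real" where
  "theta M T \<phi> p e = (if e \<in> boundary_edges M T \<phi> then pi / 2 - p e else pi - p e)"

definition ideal_disk_pattern ::
  "'m::t2_space set \<Rightarrow> 't set \<Rightarrow> ('t \<Rightarrow> real ^ 3 \<Rightarrow> 'm) \<Rightarrow> ('m set \<Rightarrow> real) \<Rightarrow> bool" where
  "ideal_disk_pattern M T \<phi> p \<longleftrightarrow>
     (\<exists>u. uniform M T \<phi> u \<and> (\<forall>e\<in>edges T \<phi>. Psi T \<phi> u e = p e))"

end

theory Submission
  imports Defs
begin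

text \<open>
  Suppose that a hyperbolic triangle has a circumscribed circle with centre \<open>O\<close> and radius \<open>r\<close>. The centre
  and a side span an isosceles triangle; let \<open>y\<close> be its (signed) base angle and \<open>2 \<phi>\<close> its angle at \<open>O\<close>. The
  radius to a corner cuts the angle at this corner into two base angles, so that the angles of the
  triangle are the sums of two of the three \<open>y\<close>, and \<open>y\<close> is the quantity \<^const>\<open>side_psi\<close> of the side.
  Right-angled trigonometry gives \<open>cot \<phi> = cosh r tan y\<close>, and the three \<open>\<phi>\<close> add up to \<open>\<pi>\<close>. Conversely,
  numbers \<open>r\<close> and \<open>y\<close> with these properties come from an inscribed triangle (\<open>inscribed_triangle\<close>).

  A uniform angle system with \<^const>\<open>Psi\<close> equal to \<open>p\<close> is therefore obtained from circle radii, one for each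
  triangle. On an interior edge between circles of radii \<open>a\<close> and \<open>b\<close>, the two base angles must
  add up to \<open>p e\<close> and the two chords must have equal length; this leaves exactly one choice of the base
  angles (\<open>base_tan\<close>, \<open>base_angles_sum\<close>, \<open>common_chord\<close>). A boundary edge, whose base angle is prescribed,
  behaves like an edge glued to itself with angle \<open>2 p e\<close>. What remains is one equation for each
  triangle: its three half central angles add up to \<open>\<pi>\<close>.

  These equations are solved by the Perron method (\<open>minimal_supersolution\<close>). The half central angles increase with
  the radius of the neighbouring circle, so the radii for which all sums are at most \<open>\<pi>\<close> are closed under
  minima; large equal radii belong to them. Their infimum solves the equations if it is positive. If it
  vanished exactly on a nonempty set \<open>S\<close> of triangles, the small circles would become Euclidean, where
  \<open>\<phi> = \<pi> / 2 - y\<close>: an edge with its sides in \<open>S\<close> would contribute \<open>\<theta>\<close> to the sum of all half central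
  angles in \<open>S\<close>, and so would an edge with one side in \<open>S\<close>, because next to a circle of positive size the
  small one sees the whole \<open>\<pi> - p e\<close>. The total, which is at most \<open>\<pi>\<close> times the number of triangles in \<open>S\<close>,
  would tend to the sum of \<open>\<theta>\<close> over the edges of \<open>S\<close>. This contradicts condition (ii)
  (\<open>circumradii_exist\<close>).

  Condition (i) gives the angle sums at the vertices: an angle at \<open>v\<close> is the sum of the base angles of two sides, so
  that every edge contributes \<open>p e\<close> once for each of its ends at \<open>v\<close> (\<open>vertex_angle_sum_eq\<close>).
\<close>

section \<open>The dual law of cosines\<close>

lemma lorentz_commute: "lorentz X Y = lorentz Y X"
  by (simp add: lorentz_def inner_commute mult.commute)

lemma lorentz_hyp_direction:
  assumes "lorentz X X = -1"
  shows "lorentz (hyp_direction X Y) (hyp_direction X Z) = lorentz Y Z + lorentz X Y * lorentz X Z"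
proof -
  have "lorentz (hyp_direction X Y) (hyp_direction X Z)
      = lorentz Y Z + lorentz X Z * lorentz Y X + lorentz X Y * lorentz X Z
        + lorentz X Y * lorentz X Z * lorentz X X"
    by (simp add: hyp_direction_def lorentz_def inner_add_left inner_add_right algebra_simps)
  then show ?thesis
    by (simp add: assms lorentz_commute[of Y X] algebra_simps)
qed

text \<open>
  The reversed Cauchy-Schwarz inequality for time-like vectors: distinct points have positive distance.
\<close>
lemma lorentz_less_minus_one:
  assumes X: "X \<in> hyperbolic_plane" and Y: "Y \<in> hyperbolic_plane" and "X \<noteq> Y"
  shows "lorentz X Y < -1"
proof (rule ccontr)
  assume "\<not> lorentz X Y < -1"
  obtain z a w b where [simp]: "X = (z, a)" "Y = (w, b)" by (metis prod.exhaust)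
  have pos: "a > 0" "b > 0" and zz: "z \<bullet> z = a\<^sup>2 - 1" and ww: "w \<bullet> w = b\<^sup>2 - 1"
    using X Y by (auto simp: hyperbolic_plane_def lorentz_def power2_eq_square)
  have ge: "z \<bullet> w \<ge> a * b - 1"
    using \<open>\<not> lorentz X Y < -1\<close> by (simp add: lorentz_def)
  have "a \<ge> 1" "b \<ge> 1"
    using zz ww inner_ge_zero[of z] inner_ge_zero[of w] pos
    by (smt (verit) power2_eq_square mult_left_le_one_le power_le_one one_power2 power2_less_imp_less)+
  then have ab: "a * b \<ge> 1" using mult_mono[of 1 a 1 b] by simp
  have "(a * b - 1)\<^sup>2 \<le> (z \<bullet> w)\<^sup>2" using ge ab by (simp add: power_mono)
  also have "\<dots> \<le> (a\<^sup>2 - 1) * (b\<^sup>2 - 1)" using Cauchy_Schwarz_ineq[of z w] zz ww by simp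
  finally have "(a - b)\<^sup>2 \<le> 0" by (simp add: power2_eq_square algebra_simps)
  then have "a = b" by simp
  have "(z - w) \<bullet> (z - w) = z \<bullet> z + w \<bullet> w - 2 * (z \<bullet> w)"
    by (simp add: inner_diff_left inner_diff_right inner_commute)
  also have "\<dots> \<le> 0" using zz ww ge \<open>a = b\<close> by (simp add: power2_eq_square)
  finally have "z = w" by (metis eq_iff_diff_eq_0 inner_eq_zero_iff inner_ge_zero order_antisym)
  with \<open>a = b\<close> \<open>X \<noteq> Y\<close> show False by simp
qed

text \<open>
  The three points have Gram determinant \<open>p\<^sup>2 + q\<^sup>2 + w\<^sup>2 - 1 - 2 p q w\<close>; by the signature of the Lorentz form
  it is minus the square of the determinant of their coordinates.
\<close>
lemma lorentz_gram_nonneg: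
  assumes "lorentz X X = -1" "lorentz Y Y = -1" "lorentz Z Z = -1"
  defines "p \<equiv> - lorentz X Y" and "q \<equiv> - lorentz X Z" and "w \<equiv> - lorentz Y Z"
  shows "p\<^sup>2 + q\<^sup>2 + w\<^sup>2 \<le> 1 + 2 * p * q * w"
proof -
  obtain x1 x2 x3 where X: "X = (Complex x1 x2, x3)" by (metis complex.exhaust prod.exhaust)
  obtain y1 y2 y3 where Y: "Y = (Complex y1 y2, y3)" by (metis complex.exhaust prod.exhaust)
  obtain z1 z2 z3 where Z: "Z = (Complex z1 z2, z3)" by (metis complex.exhaust prod.exhaust)
  define d where "d = x1 * (y2 * z3 - y3 * z2) - x2 * (y1 * z3 - y3 * z1) + x3 * (y1 * z2 - y2 * z1)"
  define xx yy zz where "xx = - lorentz X X" and "yy = - lorentz Y Y" and "zz = - lorentz Z Z"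
  \<comment> \<open>A polynomial identity in the nine coordinates, before normalization of the points.\<close>
  have "xx * yy * zz + 2 * p * q * w - xx * w\<^sup>2 - yy * q\<^sup>2 - zz * p\<^sup>2 = d\<^sup>2"
    unfolding xx_def yy_def zz_def p_def q_def w_def d_def X Y Z lorentz_def
    by (simp add: inner_complex_def power2_eq_square algebra_simps)
  moreover have "xx = 1" "yy = 1" "zz = 1" by (simp_all add: xx_def yy_def zz_def assms)
  ultimately have "1 + 2 * p * q * w - w\<^sup>2 - q\<^sup>2 - p\<^sup>2 = d\<^sup>2" by simp
  moreover have "d\<^sup>2 \<ge> 0" by simp
  ultimately show ?thesis by linarith
qed

lemma hyp_angle_eq:
  assumes "X \<in> hyperbolic_plane" "Y \<in> hyperbolic_plane" "Z \<in> hyperbolic_plane"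
  defines "p \<equiv> - lorentz X Y" and "q \<equiv> - lorentz X Z" and "w \<equiv> - lorentz Y Z"
  shows "hyp_angle X Y Z = arccos ((p * q - w) / (sqrt (p\<^sup>2 - 1) * sqrt (q\<^sup>2 - 1)))"
  using assms
  by (simp add: hyp_angle_def Let_def lorentz_hyp_direction hyperbolic_plane_def power2_eq_square add.commute)

text \<open>
  The law of cosines for an angle between sides with hyperbolic cosines \<open>p\<close> and \<open>q\<close>. The Gram inequality
  keeps the argument of \<^const>\<open>arccos\<close> in \<open>[-1, 1]\<close>; the numerator of the sine is symmetric in \<open>p, q, w\<close>,
  and this symmetry makes the dual law of cosines come out.
\<close>
lemma cosine_rule_trig:
  fixes p q w :: real
  assumes "p > 1" "q > 1" and gram: "p\<^sup>2 + q\<^sup>2 + w\<^sup>2 \<le> 1 + 2 * p * q * w"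
  defines "PQ \<equiv> sqrt (p\<^sup>2 - 1) * sqrt (q\<^sup>2 - 1)"
  defines "A \<equiv> arccos ((p * q - w) / PQ)"
  shows "cos A = (p * q - w) / PQ"
    and "sin A = sqrt (1 + 2 * p * q * w - p\<^sup>2 - q\<^sup>2 - w\<^sup>2) / PQ"
proof -
  have pos: "p\<^sup>2 - 1 > 0" "q\<^sup>2 - 1 > 0" using assms by simp_all
  then have PQ: "PQ > 0" and PQ2: "PQ\<^sup>2 = (p\<^sup>2 - 1) * (q\<^sup>2 - 1)"
    by (simp_all add: PQ_def power_mult_distrib)
  have id: "1 - ((p * q - w) / PQ)\<^sup>2 = (1 + 2 * p * q * w - p\<^sup>2 - q\<^sup>2 - w\<^sup>2) / PQ\<^sup>2"
  proof -
    have "PQ\<^sup>2 - (p * q - w)\<^sup>2 = 1 + 2 * p * q * w - p\<^sup>2 - q\<^sup>2 - w\<^sup>2"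
      unfolding PQ2 by (simp add: power2_eq_square algebra_simps)
    then show ?thesis using PQ by (simp add: power_divide diff_divide_eq_iff flip: diff_divide_distrib)
  qed
  then have "((p * q - w) / PQ)\<^sup>2 \<le> 1"
    using gram by (smt (verit) divide_nonneg_nonneg zero_le_power2)
  then have "\<bar>(p * q - w) / PQ\<bar> \<le> 1" by (simp add: abs_square_le_1)
  then have rng: "-1 \<le> (p * q - w) / PQ" "(p * q - w) / PQ \<le> 1" by linarith+
  show "cos A = (p * q - w) / PQ" unfolding A_def by (rule cos_arccos[OF rng])
  show "sin A = sqrt (1 + 2 * p * q * w - p\<^sup>2 - q\<^sup>2 - w\<^sup>2) / PQ"
    unfolding A_def sin_arccos[OF rng] id using PQ by (simp add: real_sqrt_divide)
qed

text \<open>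
  The angles of a realization determine its sides. This gives the uniqueness behind
  \<^const>\<open>hyp_side_length\<close>, a definite description over all realizations.
\<close>
lemma dual_cosine_rule:
  assumes real: "hyp_realization A B C X Y Z"
  shows "- lorentz Y Z * (sin B * sin C) = cos A + cos B * cos C"
proof -
  define p q w where "p = - lorentz X Y" and "q = - lorentz X Z" and "w = - lorentz Y Z"
  have H: "X \<in> hyperbolic_plane" "Y \<in> hyperbolic_plane" "Z \<in> hyperbolic_plane"
    and "X \<noteq> Y" "Y \<noteq> Z" "Z \<noteq> X"
    and ang: "A = hyp_angle X Y Z" "B = hyp_angle Y Z X" "C = hyp_angle Z X Y"
    using real by (auto simp: hyp_realization_def)
  then have gt: "p > 1" "q > 1" "w > 1"
    using lorentz_less_minus_one[of X Y] lorentz_less_minus_one[of X Z] lorentz_less_minus_one[of Y Z]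
    by (auto simp: p_def q_def w_def)
  define P Q W where "P = sqrt (p\<^sup>2 - 1)" and "Q = sqrt (q\<^sup>2 - 1)" and "W = sqrt (w\<^sup>2 - 1)"
  define d where "d = 1 + 2 * p * q * w - p\<^sup>2 - q\<^sup>2 - w\<^sup>2"
  have pos: "P > 0" "Q > 0" "W > 0" using gt by (simp_all add: P_def Q_def W_def)
  have W2: "W\<^sup>2 = w\<^sup>2 - 1" using gt by (simp add: W_def)
  have gram: "p\<^sup>2 + q\<^sup>2 + w\<^sup>2 \<le> 1 + 2 * p * q * w"
    using lorentz_gram_nonneg[of X Y Z] H by (simp add: p_def q_def w_def hyperbolic_plane_def)
  have A: "A = arccos ((p * q - w) / (P * Q))"
    unfolding ang P_def Q_def p_def q_def w_def using hyp_angle_eq H by simp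
  have B: "B = arccos ((w * p - q) / (W * P))"
    unfolding ang P_def W_def p_def q_def w_def using hyp_angle_eq[of Y Z X] H
    by (simp add: lorentz_commute)
  have C: "C = arccos ((q * w - p) / (Q * W))"
    unfolding ang Q_def W_def p_def q_def w_def using hyp_angle_eq[of Z X Y] H
    by (simp add: lorentz_commute)
  have cA: "cos A = (p * q - w) / (P * Q)"
    using cosine_rule_trig(1)[of p q w] gt gram by (simp add: A P_def Q_def)
  have B': "cos B = (w * p - q) / (W * P)" "sin B = sqrt d / (W * P)"
    using cosine_rule_trig[of w p q] gt gram
    by (simp_all add: B P_def W_def d_def algebra_simps)
  have C': "cos C = (q * w - p) / (Q * W)" "sin C = sqrt d / (Q * W)"
    using cosine_rule_trig[of q w p] gt gram
    by (simp_all add: C Q_def W_def d_def algebra_simps)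
  \<comment> \<open>Both sides are brought to the denominator \<open>P Q W\<^sup>2\<close>; their numerators are multiples of \<open>d\<close>.\<close>
  have "sin B * sin C = d / (P * Q * W\<^sup>2)"
    using gram by (simp add: B' C' d_def power2_eq_square algebra_simps)
  moreover have "cos A + cos B * cos C = ((p * q - w) * W\<^sup>2 + (w * p - q) * (q * w - p)) / (P * Q * W\<^sup>2)"
    using pos by (simp add: cA B' C' power2_eq_square field_simps)
  moreover have "(p * q - w) * W\<^sup>2 + (w * p - q) * (q * w - p) = w * d"
    unfolding W2 d_def by (simp add: power2_eq_square algebra_simps)
  ultimately show ?thesis by (simp add: w_def)
qed

lemma hyp_side_length_eq:
  assumes real: "hyp_realization A B C X Y Z"
    and "0 < B" "B < pi" "0 < C" "C < pi"
  shows "hyp_side_length A B C = hyp_dist Y Z"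
  unfolding hyp_side_length_def
proof (rule the_equality)
  show "\<exists>X' Y' Z'. hyp_realization A B C X' Y' Z' \<and> hyp_dist Y Z = hyp_dist Y' Z'"
    using real by blast
next
  fix l assume "\<exists>X' Y' Z'. hyp_realization A B C X' Y' Z' \<and> l = hyp_dist Y' Z'"
  then obtain X' Y' Z' where real': "hyp_realization A B C X' Y' Z'" and l: "l = hyp_dist Y' Z'"
    by blast
  have "sin B * sin C \<noteq> 0" using assms(2-5) sin_gt_zero by fastforce
  then have "lorentz Y' Z' = lorentz Y Z"
    using dual_cosine_rule[OF real] dual_cosine_rule[OF real']
    by (metis minus_equation_iff mult_right_cancel)
  then show "l = hyp_dist Y Z" by (simp add: l hyp_dist_def)
qed

section \<open>Triangles inscribed in a circle\<close>

text \<open>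
  A right hyperbolic triangle has hypotenuse \<open>r\<close> and acute angles \<open>\<phi>\<close> and \<open>y = arctan u\<close>, so
  \<open>cot \<phi> = cosh r tan y\<close>. It is half of the isosceles triangle spanned by a chord and the centre of a
  circle of radius \<open>r\<close>, and \<open>D\<close> is the hyperbolic cosine of half the chord. A negative \<open>u\<close> means that the
  centre lies on the far side of the chord.
\<close>
lemma trig_base_angle:
  fixes r u :: real
  defines "\<phi> \<equiv> pi / 2 - arctan (cosh r * u)"
  defines "D \<equiv> sqrt (1 + (sinh r)\<^sup>2 * (sin \<phi>)\<^sup>2)"
  shows "0 < \<phi>" "\<phi> < pi" "0 < sin \<phi>" "0 < D"
    and "cos (arctan u) = cosh r * sin \<phi> / D"
    and "sin (arctan u) = cos \<phi> / D"
    and "(sin \<phi>)\<^sup>2 = 1 / (1 + (cosh r * u)\<^sup>2)"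
proof -
  show p: "0 < \<phi>" "\<phi> < pi" using arctan[of "cosh r * u"] by (auto simp: \<phi>_def)
  then show s: "0 < sin \<phi>" by (simp add: sin_gt_zero)
  show D: "0 < D" unfolding D_def by (smt (verit) real_sqrt_gt_zero zero_le_power2 mult_nonneg_nonneg)
  have sc: "sin \<phi> = cos (arctan (cosh r * u))" "cos \<phi> = sin (arctan (cosh r * u))"
    by (simp_all add: \<phi>_def cos_diff sin_diff)
  have ct: "cos \<phi> = cosh r * u * sin \<phi>"
    using tan_arctan[of "cosh r * u"] s unfolding sc tan_def by (simp add: field_simps)
  have "1 = (sin \<phi>)\<^sup>2 * (1 + (cosh r * u)\<^sup>2)"
    using sin_cos_squared_add[of \<phi>] unfolding ct by (simp add: algebra_simps power_mult_distrib)
  then show s2: "(sin \<phi>)\<^sup>2 = 1 / (1 + (cosh r * u)\<^sup>2)"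
    by (metis nonzero_eq_divide_eq mult_zero_right zero_neq_one)
  have "1 + (sinh r)\<^sup>2 * (sin \<phi>)\<^sup>2 = (cosh r * sin \<phi>)\<^sup>2 * (1 + u\<^sup>2)"
    using \<open>1 = (sin \<phi>)\<^sup>2 * (1 + (cosh r * u)\<^sup>2)\<close> cosh_square_eq[of r]
    by (simp add: power_mult_distrib algebra_simps)
  then have "D = cosh r * sin \<phi> * sqrt (1 + u\<^sup>2)"
    using s by (simp add: D_def real_sqrt_mult)
  moreover have "sqrt (1 + u\<^sup>2) > 0" by (smt (verit) real_sqrt_gt_zero zero_le_power2)
  ultimately show "cos (arctan u) = cosh r * sin \<phi> / D" "sin (arctan u) = cos \<phi> / D"
    using s by (simp_all add: cos_arctan sin_arctan ct)
qed

text \<open>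
  The law of cosines at a corner of an inscribed triangle: the radius to this corner cuts the angle
  into the base angles of the two adjacent isosceles triangles. The chords with half central angles
  \<open>\<beta>\<close>, \<open>\<gamma>\<close>, \<open>\<alpha>\<close> have hyperbolic cosines \<open>q\<close>, \<open>p\<close>, \<open>w\<close>, where \<open>sin \<alpha> = sin (\<beta> + \<gamma>)\<close>.
\<close>
lemma circle_angle:
  fixes r u v :: real
  assumes "r > 0"
  defines "\<beta> \<equiv> pi / 2 - arctan (cosh r * u)" and "\<gamma> \<equiv> pi / 2 - arctan (cosh r * v)"
  defines "q \<equiv> 1 + 2 * (sinh r)\<^sup>2 * (sin \<beta>)\<^sup>2" and "p \<equiv> 1 + 2 * (sinh r)\<^sup>2 * (sin \<gamma>)\<^sup>2"
    and "w \<equiv> 1 + 2 * (sinh r)\<^sup>2 * (sin (\<beta> + \<gamma>))\<^sup>2"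
  shows "(p * q - w) / (sqrt (p\<^sup>2 - 1) * sqrt (q\<^sup>2 - 1)) = cos (arctan u + arctan v)"
proof -
  define s where "s = sinh r"
  define b b' c c' where "b = sin \<beta>" and "b' = cos \<beta>" and "c = sin \<gamma>" and "c' = cos \<gamma>"
  have s: "s > 0" using assms by (simp add: s_def)
  define D E where "D = sqrt (1 + s\<^sup>2 * b\<^sup>2)" and "E = sqrt (1 + s\<^sup>2 * c\<^sup>2)"
  note tb = trig_base_angle[where r = r and u = u, folded \<beta>_def s_def, folded b_def b'_def, folded D_def]
  note tc = trig_base_angle[where r = r and u = v, folded \<gamma>_def s_def, folded c_def c'_def, folded E_def]
  have D2: "D\<^sup>2 = 1 + s\<^sup>2 * b\<^sup>2" "E\<^sup>2 = 1 + s\<^sup>2 * c\<^sup>2"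
    by (simp_all add: D_def E_def)
  have "q\<^sup>2 - 1 = (2 * s * b * D)\<^sup>2" "p\<^sup>2 - 1 = (2 * s * c * E)\<^sup>2"
    unfolding power_mult_distrib D2 q_def p_def
    by (simp_all add: s_def b_def c_def power2_eq_square algebra_simps)
  then have sq: "sqrt (q\<^sup>2 - 1) = 2 * s * b * D" "sqrt (p\<^sup>2 - 1) = 2 * s * c * E"
    using s tb tc by simp_all
  have cb: "b'\<^sup>2 = 1 - b\<^sup>2" "c'\<^sup>2 = 1 - c\<^sup>2"
    unfolding b_def b'_def c_def c'_def by (simp_all add: cos_squared_eq)
  have "(sin (\<beta> + \<gamma>))\<^sup>2 = (b * c' + b' * c)\<^sup>2"
    by (simp add: sin_add b_def b'_def c_def c'_def)
  also have "\<dots> = b\<^sup>2 * c'\<^sup>2 + b'\<^sup>2 * c\<^sup>2 + 2 * b * b' * c * c'"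
    by (simp add: power2_eq_square algebra_simps)
  also have "\<dots> = b\<^sup>2 + c\<^sup>2 - 2 * b\<^sup>2 * c\<^sup>2 + 2 * b * b' * c * c'"
    unfolding cb by (simp add: algebra_simps)
  finally have w: "w = 1 + 2 * s\<^sup>2 * (b\<^sup>2 + c\<^sup>2 - 2 * b\<^sup>2 * c\<^sup>2 + 2 * b * b' * c * c')"
    by (simp add: w_def s_def)
  have ch: "(cosh r)\<^sup>2 = 1 + s\<^sup>2" by (simp add: s_def cosh_square_eq)
  have "p * q - w = 4 * s\<^sup>2 * b * c * ((cosh r)\<^sup>2 * b * c - b' * c')"
    unfolding w ch p_def q_def
    by (simp add: s_def[symmetric] b_def[symmetric] c_def[symmetric] power2_eq_square algebra_simps)
  then have "(p * q - w) / (sqrt (p\<^sup>2 - 1) * sqrt (q\<^sup>2 - 1)) = ((cosh r)\<^sup>2 * b * c - b' * c') / (D * E)"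
    unfolding sq \<open>p * q - w = _\<close> using s tb(3,4) tc(3,4) by (simp add: power2_eq_square)
  also have "\<dots> = cos (arctan u) * cos (arctan v) - sin (arctan u) * sin (arctan v)"
  proof -
    have e: "cos (arctan u) = cosh r * b / D" "sin (arctan u) = b' / D"
      "cos (arctan v) = cosh r * c / E" "sin (arctan v) = c' / E"
      by (simp_all add: tb(5,6) tc(5,6))
    show ?thesis unfolding e by (simp add: power2_eq_square diff_divide_distrib)
  qed
  finally show ?thesis by (simp add: cos_add)
qed

lemma arctan_sum_pos:
  fixes u v c :: real
  assumes "c > 0" and "arctan (c * u) + arctan (c * v) > 0"
  shows "0 < arctan u + arctan v"
proof -
  have "arctan (c * u) > arctan (- (c * v))" using assms by (simp add: arctan_minus)
  then have "c * u > c * (- v)" by (simp add: arctan_less_iff)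
  then have "u > - v" using assms mult_less_cancel_left_pos by blast
  then show ?thesis using arctan_less_iff[of "- v" u] by (simp add: arctan_minus)
qed

text \<open>
  An inscribed triangle has angle sum less than \<open>\<pi>\<close>, that is, base angles of sum less than \<open>\<pi> / 2\<close>.
  The cosine of a sum of three arc tangents has the sign of \<open>1 - e\<close>, where \<open>e\<close> is the second elementary
  symmetric function of the tangents. The hypothesis says \<open>c\<^sup>2 e = 1\<close>, hence \<open>e < 1\<close>.
\<close>
lemma arctan_sum_less:
  fixes c u v w :: real
  assumes "c > 1" and sum: "arctan (c * u) + arctan (c * v) + arctan (c * w) = pi / 2"
  shows "arctan u + arctan v + arctan w < pi / 2"
proof -
  have cos3: "cos (arctan a + arctan b + arctan d)
      = cos (arctan a) * cos (arctan b) * cos (arctan d) * (1 - (a * b + b * d + a * d))" for a b d :: real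
  proof -
    have "sin (arctan x) = x * cos (arctan x)" for x :: real
      using tan_arctan[of x] unfolding tan_def by (simp add: field_simps)
    then show ?thesis by (simp add: cos_add sin_add algebra_simps)
  qed
  have pos: "cos (arctan x) > 0" for x :: real
    using arctan[of x] by (intro cos_gt_zero_pi) auto
  have "cos (arctan (c * u) + arctan (c * v) + arctan (c * w)) = 0" unfolding sum by simp
  then have "c * u * (c * v) + c * v * (c * w) + c * u * (c * w) = 1"
    unfolding cos3 using pos by (simp add: less_imp_neq[symmetric])
  then have "c\<^sup>2 * (u * v + v * w + u * w) = 1"
    by (simp add: power2_eq_square algebra_simps)
  moreover have "c\<^sup>2 > 1" using assms by simp
  ultimately have "u * v + v * w + u * w < 1"
    by (smt (verit) mult_less_cancel_left_pos mult_cancel_left1 mult_le_cancel_left1)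
  then have cpos: "cos (arctan u + arctan v + arctan w) > 0"
    unfolding cos3 using pos by simp
  show ?thesis
  proof (rule ccontr)
    assume ge: "\<not> ?thesis"
    have "arctan u + arctan v + arctan w < 3 * (pi / 2)"
      using arctan[of u] arctan[of v] arctan[of w] by linarith
    then have "cos (arctan u + arctan v + arctan w - pi) \<ge> 0"
      using ge by (intro cos_ge_zero) linarith+
    then show False using cpos by simp
  qed
qed

text \<open>
  The vertices are placed on the circle of radius \<open>r\<close> about \<open>(0, 1)\<close>, at the polar angles \<open>0\<close>, \<open>2 \<gamma>\<close> and
  \<open>- 2 \<beta>\<close>; the third arc is then \<open>2 \<pi> - 2 \<beta> - 2 \<gamma> = 2 \<alpha>\<close>.
\<close>
lemma inscribed_realization:
  fixes r :: real and u v w :: real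
  assumes "r > 0"
  defines "\<alpha> \<equiv> pi / 2 - arctan (cosh r * u)" and "\<beta> \<equiv> pi / 2 - arctan (cosh r * v)"
    and "\<gamma> \<equiv> pi / 2 - arctan (cosh r * w)"
  assumes sum: "\<alpha> + \<beta> + \<gamma> = pi"
  shows "\<exists>X Y Z. hyp_realization (arctan v + arctan w) (arctan w + arctan u) (arctan u + arctan v) X Y Z
           \<and> - lorentz Y Z = 1 + 2 * (sinh r)\<^sup>2 * (sin \<alpha>)\<^sup>2"
proof -
  define pt where "pt t = (complex_of_real (sinh r) * cis t, cosh r)" for t
  have lor: "lorentz (pt a) (pt b) = - (1 + 2 * (sinh r)\<^sup>2 * (sin ((a - b) / 2))\<^sup>2)" for a b
  proof -
    have "lorentz (pt a) (pt b) = (sinh r)\<^sup>2 * cos (a - b) - (cosh r)\<^sup>2"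
      by (simp add: lorentz_def pt_def inner_complex_def cos_diff power2_eq_square algebra_simps)
    moreover have "cos (a - b) = 1 - 2 * (sin ((a - b) / 2))\<^sup>2"
    proof -
      define h where "h = (a - b) / 2"
      have "a - b = 2 * h" by (simp add: h_def)
      then show ?thesis by (simp only: cos_double_sin) simp
    qed
    ultimately show ?thesis
      using cosh_square_eq[of r] by (simp add: algebra_simps)
  qed
  have H: "pt a \<in> hyperbolic_plane" for a
    using lor[of a a] by (simp add: hyperbolic_plane_def) (simp add: pt_def)
  define X Y Z where "X = pt 0" and "Y = pt (2 * \<gamma>)" and "Z = pt (- 2 * \<beta>)"
  have [simp]: "sin (\<beta> + \<gamma>) = sin \<alpha>"
    using sum sin_pi_minus[of "\<alpha>"] by (metis add_diff_cancel_left' add.assoc)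
  have [simp]: "sin (\<gamma> + \<alpha>) = sin \<beta>" "sin (\<alpha> + \<beta>) = sin \<gamma>"
    using sum sin_pi_minus[of \<beta>] sin_pi_minus[of \<gamma>] by (smt (verit))+
  have p: "- lorentz X Y = 1 + 2 * (sinh r)\<^sup>2 * (sin \<gamma>)\<^sup>2"
    and q: "- lorentz X Z = 1 + 2 * (sinh r)\<^sup>2 * (sin \<beta>)\<^sup>2"
    and w: "- lorentz Y Z = 1 + 2 * (sinh r)\<^sup>2 * (sin \<alpha>)\<^sup>2"
  proof -
    have "(2 * \<gamma> - (- 2 * \<beta>)) / 2 = \<beta> + \<gamma>" by simp
    then have "sin ((2 * \<gamma> - (- 2 * \<beta>)) / 2) = sin \<alpha>" by (simp only: \<open>sin (\<beta> + \<gamma>) = sin \<alpha>\<close>)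
    then show "- lorentz Y Z = 1 + 2 * (sinh r)\<^sup>2 * (sin \<alpha>)\<^sup>2"
      unfolding Y_def Z_def lor by simp
  qed (simp_all add: X_def Y_def Z_def lor)
  note ta = trig_base_angle[where r = r and u = u, folded \<alpha>_def]
  note tb = trig_base_angle[where r = r and u = v, folded \<beta>_def]
  note tc = trig_base_angle[where r = r and u = w, folded \<gamma>_def]
  have HX: "X \<in> hyperbolic_plane" "Y \<in> hyperbolic_plane" "Z \<in> hyperbolic_plane"
    by (simp_all add: X_def Y_def Z_def H)
  have ne: "X \<noteq> Y" "Y \<noteq> Z" "Z \<noteq> X"
    using p q w ta(3) tb(3) tc(3) HX assms(1) by (auto simp: hyperbolic_plane_def)
  have c0: "cosh r > 0" by simp
  have y: "0 < arctan v + arctan w" "0 < arctan w + arctan u" "0 < arctan u + arctan v"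
    using sum ta(1,2) tb(1,2) tc(1,2)
    by - (rule arctan_sum_pos[OF c0], simp add: \<alpha>_def \<beta>_def \<gamma>_def)+
  have y': "arctan v + arctan w \<le> pi" "arctan w + arctan u \<le> pi" "arctan u + arctan v \<le> pi"
    using arctan[of u] arctan[of v] arctan[of w] by linarith+
  have "hyp_angle X Y Z = arctan v + arctan w"
    using hyp_angle_eq[OF HX] circle_angle[OF assms(1), where u = v and v = w, folded \<beta>_def \<gamma>_def] y(1) y'(1)
    unfolding p q w by (simp add: arccos_cos)
  moreover have "hyp_angle Y Z X = arctan w + arctan u"
    using hyp_angle_eq[OF HX(2,3,1)] circle_angle[OF assms(1), where u = w and v = u, folded \<alpha>_def \<gamma>_def] y(2) y'(2)
    unfolding lorentz_commute[of Y X] lorentz_commute[of Z X] p q w by (simp add: arccos_cos)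
  moreover have "hyp_angle Z X Y = arctan u + arctan v"
    using hyp_angle_eq[OF HX(3,1,2)] circle_angle[OF assms(1), where u = u and v = v, folded \<alpha>_def \<beta>_def] y(3) y'(3)
    unfolding lorentz_commute[of Z Y] lorentz_commute[of Z X] p q w by (simp add: arccos_cos)
  ultimately have "hyp_realization (arctan v + arctan w) (arctan w + arctan u) (arctan u + arctan v) X Y Z"
    using HX ne by (simp add: hyp_realization_def)
  then show ?thesis using w by blast
qed

text \<open>
  All that is needed later about a single triangle: if the half central angles over its three sides add
  up to \<open>\<pi>\<close>, the sums of two base angles are the angles of a hyperbolic triangle, and the length of a
  side depends only on the chord of the circle cut off by it.
\<close>
lemma inscribed_triangle:
  fixes r :: real and u v w :: real
  assumes "r > 0"
    and sum: "(pi / 2 - arctan (cosh r * u)) + (pi / 2 - arctan (cosh r * v))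
               + (pi / 2 - arctan (cosh r * w)) = pi"
  shows "0 < arctan u + arctan v"
    and "arctan u + arctan v + arctan w < pi / 2"
    and "hyp_side_length (arctan v + arctan w) (arctan w + arctan u) (arctan u + arctan v)
           = arcosh (1 + 2 * (sinh r)\<^sup>2 / (1 + (cosh r * u)\<^sup>2))"
proof -
  have c: "cosh r > 1" using assms(1) cosh_real_strict_mono[of 0 r] by simp
  have c0: "cosh r > 0" by simp
  have y: "0 < arctan w + arctan u" "0 < arctan u + arctan v"
    using sum arctan[of "cosh r * v"] arctan[of "cosh r * w"]
    by - (rule arctan_sum_pos[OF c0], simp)+
  then show "0 < arctan u + arctan v" by simp
  show "arctan u + arctan v + arctan w < pi / 2"
    using sum by (intro arctan_sum_less[OF c]) simp
  obtain X Y Z where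
    real: "hyp_realization (arctan v + arctan w) (arctan w + arctan u) (arctan u + arctan v) X Y Z"
    and l: "- lorentz Y Z = 1 + 2 * (sinh r)\<^sup>2 * (sin (pi / 2 - arctan (cosh r * u)))\<^sup>2"
    using inscribed_realization[OF assms] by blast
  have "arctan w + arctan u < pi" "arctan u + arctan v < pi"
    using arctan[of u] arctan[of v] arctan[of w] by linarith+
  then show "hyp_side_length (arctan v + arctan w) (arctan w + arctan u) (arctan u + arctan v)
           = arcosh (1 + 2 * (sinh r)\<^sup>2 / (1 + (cosh r * u)\<^sup>2))"
    using hyp_side_length_eq[OF real] y l trig_base_angle(7)[where r = r and u = u] by (simp add: hyp_dist_def)
qed

section \<open>Intersecting circles\<close>

text \<open>
  Two circles of radii \<open>a\<close> and \<open>b\<close> meet in \<open>P\<close>, and the radii to \<open>P\<close> form the angle \<open>\<omega>\<close>. The common chord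
  splits \<open>\<omega>\<close> into a part \<open>y\<close> on the side of the first centre and \<open>\<omega> - y\<close> on the side of the second one.
  Computing half the chord from either side gives \<open>tanh a cos y = tanh b cos (\<omega> - y)\<close>; solved for \<open>tan y\<close>
  this is the formula below.
\<close>
definition base_tan :: "real \<Rightarrow> real \<Rightarrow> real \<Rightarrow> real" where
  "base_tan a b \<omega> = (tanh a / tanh b - cos \<omega>) / sin \<omega>"

text \<open>
  Half of the angle under which the centre of the first circle sees the common chord.
\<close>
definition half_central_angle :: "real \<Rightarrow> real \<Rightarrow> real \<Rightarrow> real" where
  "half_central_angle a b \<omega> = pi / 2 - arctan (cosh a * base_tan a b \<omega>)"

lemma base_angles_sum:
  assumes "a > 0" "b > 0" and \<omega>: "0 < \<omega>" "\<omega> < pi"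
  shows "arctan (base_tan a b \<omega>) + arctan (base_tan b a \<omega>) = \<omega>"
proof -
  define k where "k = tanh a / tanh b"
  define y where "y = arctan (base_tan a b \<omega>)"
  have k: "k > 0" "tanh b / tanh a = 1 / k" using assms by (simp_all add: k_def)
  have s: "sin \<omega> > 0" using \<omega> by (simp add: sin_gt_zero)
  have yr: "- (pi / 2) < y" "y < pi / 2" and ty: "tan y = (k - cos \<omega>) / sin \<omega>"
    using arctan[of "base_tan a b \<omega>"] by (simp_all add: y_def base_tan_def k_def)
  have cy: "cos y > 0" using yr by (intro cos_gt_zero_pi)
  have sy: "sin y = (k - cos \<omega>) / sin \<omega> * cos y"
    using ty cy unfolding tan_def by (simp add: field_simps)
  have "cos (\<omega> - y) = cos y * (cos \<omega> + sin \<omega> * ((k - cos \<omega>) / sin \<omega>))"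
    unfolding cos_diff sy by (simp only: algebra_simps)
  then have c: "cos (\<omega> - y) = k * cos y" using s by simp
  have "sin (\<omega> - y) * sin \<omega> = cos y * ((sin \<omega>)\<^sup>2 - cos \<omega> * (k - cos \<omega>))"
  proof -
    define q where "q = cos \<omega> * (k - cos \<omega>) * cos y"
    have "sin (\<omega> - y) = sin \<omega> * cos y - q / sin \<omega>"
      unfolding sin_diff sy q_def by simp
    then have "sin (\<omega> - y) * sin \<omega> = sin \<omega> * cos y * sin \<omega> - q"
      using s by (simp add: left_diff_distrib)
    then show ?thesis by (simp only: q_def power2_eq_square algebra_simps)
  qed
  also have "\<dots> = cos y * (1 - k * cos \<omega>)"
    by (simp add: sin_squared_eq) (simp add: power2_eq_square algebra_simps)
  finally have sn: "sin (\<omega> - y) = cos y * (1 - k * cos \<omega>) / sin \<omega>"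
    using s by (simp add: field_simps)
  have "tan (\<omega> - y) = (1 / k - cos \<omega>) / sin \<omega>"
    unfolding tan_def c sn using s k cy by (simp add: field_simps)
  moreover have "\<omega> - y < pi / 2"
  proof (rule ccontr)
    assume "\<not> \<omega> - y < pi / 2"
    then have "cos (\<omega> - y - pi) \<ge> 0" using \<omega> yr by (intro cos_ge_zero) linarith+
    moreover have "cos (\<omega> - y) > 0" using c k cy by simp
    ultimately show False by simp
  qed
  moreover have "- (pi / 2) < \<omega> - y" using \<omega> yr by linarith
  ultimately have "arctan ((1 / k - cos \<omega>) / sin \<omega>) = \<omega> - y"
    by (intro arctan_unique)
  then show ?thesis by (simp add: y_def base_tan_def[of b a] k)
qed

text \<open>
  By \<open>trig_base_angle\<close> both sides are \<open>sinh\<^sup>2\<close> of half the common chord, computed from the first and from the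
  second circle. Expanded, the expression is symmetric in the two circles.
\<close>
lemma common_chord:
  assumes "a > 0" "b > 0" and \<omega>: "0 < \<omega>" "\<omega> < pi"
  shows "(sinh a)\<^sup>2 / (1 + (cosh a * base_tan a b \<omega>)\<^sup>2) = (sinh b)\<^sup>2 / (1 + (cosh b * base_tan b a \<omega>)\<^sup>2)"
proof -
  \<comment> \<open>The symmetric denominator to which both sides reduce.\<close>
  define N where "N a b = (sinh a)\<^sup>2 + (sinh b)\<^sup>2 + (sinh a)\<^sup>2 * (sinh b)\<^sup>2 * (1 + (cos \<omega>)\<^sup>2)
    - 2 * sinh a * sinh b * cosh a * cosh b * cos \<omega>" for a b
  have "(sinh a)\<^sup>2 / (1 + (cosh a * base_tan a b \<omega>)\<^sup>2) = (sinh a)\<^sup>2 * (sinh b)\<^sup>2 * (sin \<omega>)\<^sup>2 / N a b"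
    if "a > 0" "b > 0" for a b
  proof -
    define A c B d C s where "A = sinh a" and "c = cosh a" and "B = sinh b" and "d = cosh b"
      and "C = cos \<omega>" and "s = sin \<omega>"
    have pos: "A > 0" "B > 0" "s > 0" "c > 0" "d > 0"
      using that \<omega> by (simp_all add: A_def B_def s_def c_def d_def sin_gt_zero)
    have "c * base_tan a b \<omega> = (A * d - c * C * B) / (B * s)"
      using pos by (simp add: base_tan_def tanh_def field_simps flip: A_def c_def B_def d_def C_def s_def)
    then have "1 + (c * base_tan a b \<omega>)\<^sup>2 = ((B * s)\<^sup>2 + (A * d - c * C * B)\<^sup>2) / (B * s)\<^sup>2"
      using pos by (simp add: power_divide add_divide_distrib)
    also have "(B * s)\<^sup>2 + (A * d - c * C * B)\<^sup>2
        = B\<^sup>2 * s\<^sup>2 + A\<^sup>2 * d\<^sup>2 - 2 * A * B * c * d * C + c\<^sup>2 * C\<^sup>2 * B\<^sup>2"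
      by (simp add: power2_eq_square algebra_simps)
    also have "\<dots> = B\<^sup>2 * (1 - C\<^sup>2) + A\<^sup>2 * (B\<^sup>2 + 1) - 2 * A * B * c * d * C + (A\<^sup>2 + 1) * C\<^sup>2 * B\<^sup>2"
      by (simp add: A_def B_def c_def d_def C_def s_def sin_squared_eq cosh_square_eq)
    also have "\<dots> = N a b"
      unfolding N_def A_def[symmetric] B_def[symmetric] c_def[symmetric] d_def[symmetric] C_def[symmetric]
      by (simp add: algebra_simps)
    finally show ?thesis
      by (simp add: A_def B_def c_def s_def power_mult_distrib)
  qed
  note this[OF assms(1,2)] this[OF assms(2,1)]
  moreover have "N a b = N b a" by (simp add: N_def algebra_simps)
  ultimately show ?thesis by (simp add: algebra_simps)
qed

text \<open>
  The monotonicity on which the existence proof rests: enlarging the neighbouring circle makes the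
  common chord appear larger from the centre of the fixed one.
\<close>
lemma half_central_angle_mono:
  assumes "0 < a" "0 < b" "b \<le> b'" "0 < \<omega>" "\<omega> < pi"
  shows "half_central_angle a b \<omega> \<le> half_central_angle a b' \<omega>"
proof -
  have "tanh b \<le> tanh b'" "tanh b > 0" "tanh a > 0" using assms by simp_all
  then have "tanh a / tanh b' \<le> tanh a / tanh b"
    by (intro divide_left_mono) auto
  then show ?thesis
    using assms sin_gt_zero[of \<omega>]
    by (simp add: half_central_angle_def base_tan_def divide_right_mono arctan_le_iff)
qed

lemma arctan_mult_le:
  fixes c u :: real
  assumes "1 \<le> c"
  shows "arctan (c * u) \<le> arctan u + (c - 1) / 2"
proof (cases "c = 1")
  case False
  with assms have "1 < c" by simp
  have "\<exists>z>1. z < c \<and> arctan (c * u) - arctan (1 * u) = (c - 1) * (u / (1 + (z * u)\<^sup>2))"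
    by (rule MVT2[OF \<open>1 < c\<close>]) (auto intro!: derivative_eq_intros simp: divide_inverse)
  then obtain z where z: "z > 1" "arctan (c * u) - arctan u = (c - 1) * (u / (1 + (z * u)\<^sup>2))"
    by auto
  have "u / (1 + (z * u)\<^sup>2) \<le> 1 / 2"
  proof -
    have "2 * u \<le> 1 + u\<^sup>2" using sum_squares_bound[of 1 u] by simp
    also have "u\<^sup>2 \<le> (z * u)\<^sup>2" using z(1) by (simp add: power_mult_distrib mult_le_cancel_right1)
    finally have "2 * u \<le> 1 + (z * u)\<^sup>2" by simp
    moreover have "1 + (z * u)\<^sup>2 > 0" by (simp add: add_pos_nonneg)
    ultimately show ?thesis by (simp add: field_simps)
  qed
  then have "(c - 1) * (u / (1 + (z * u)\<^sup>2)) \<le> (c - 1) * (1 / 2)"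
    using \<open>1 < c\<close> by (intro mult_left_mono) auto
  then have "(c - 1) * (u / (1 + (z * u)\<^sup>2)) \<le> (c - 1) / 2" by (simp only: mult_1_right times_divide_eq_right)
  then show ?thesis using z(2) by linarith
qed simp

text \<open>
  For a small circle of radius \<open>a\<close> the right triangle is almost Euclidean, so that \<open>\<phi>\<close> is close to
  \<open>\<pi> / 2 - y\<close>. The error is bounded independently of \<open>b\<close> and \<open>\<omega>\<close>, so that nothing has to be known about
  the ratio of two radii which tend to zero together.
\<close>
lemma half_central_angle_ge:
  "pi / 2 - arctan (base_tan a b \<omega>) - (cosh a - 1) / 2 \<le> half_central_angle a b \<omega>"
  using arctan_mult_le[OF cosh_real_ge_1[of a], of "base_tan a b \<omega>"]
  by (simp add: half_central_angle_def)

text \<open>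
  A circle that shrinks to a point next to a circle of positive size ends up seeing
  \<open>\<pi> / 2 - y = \<pi> - \<omega>\<close>, the full weight of their common edge.
\<close>
lemma tendsto_base_angle_zero:
  assumes "(a \<longlongrightarrow> 0) F" "(b \<longlongrightarrow> m) F" "m > 0" and \<omega>: "0 < \<omega>" "\<omega> < pi"
  shows "((\<lambda>n. arctan (base_tan (a n) (b n) \<omega>)) \<longlongrightarrow> \<omega> - pi / 2) F"
proof -
  have s: "sin \<omega> > 0" using \<omega> by (simp add: sin_gt_zero)
  have "((\<lambda>n. arctan (base_tan (a n) (b n) \<omega>)) \<longlongrightarrow> arctan ((tanh 0 / tanh m - cos \<omega>) / sin \<omega>)) F"
    unfolding base_tan_def using assms s by (intro tendsto_intros) auto
  moreover have "arctan ((tanh 0 / tanh m - cos \<omega>) / sin \<omega>) = \<omega> - pi / 2"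
    by (rule arctan_unique) (use \<omega> in \<open>simp_all add: tan_def sin_diff cos_diff\<close>)
  ultimately show ?thesis by simp
qed

section \<open>Existence of circumradii\<close>

text \<open>
  The Perron method. If \<open>G t\<close> increases with the values at the other points, the supersolutions
  \<open>G \<le> c\<close> are closed under pointwise minima, so that their infimum \<open>m\<close> is a limit of supersolutions. A
  positive \<open>m\<close> is itself a supersolution, and strict inequality at \<open>t\<close> would allow decreasing \<open>m t\<close>. The
  last hypothesis excludes that \<open>m\<close> vanishes anywhere.
\<close>
lemma minimal_supersolution:
  fixes G :: "'a \<Rightarrow> ('a \<Rightarrow> real) \<Rightarrow> real"
  assumes fin: "finite T"
    and mono: "\<And>t r r'. t \<in> T \<Longrightarrow> (\<And>s. s \<in> T \<Longrightarrow> 0 < r s \<and> r s \<le> r' s) \<Longrightarrow> r t = r' t \<Longrightarrow> G t r \<le> G t r'"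
    and cont: "\<And>t X r. t \<in> T \<Longrightarrow> (\<And>s. s \<in> T \<Longrightarrow> 0 < r s) \<Longrightarrow>
        (\<And>s. s \<in> T \<Longrightarrow> (\<lambda>n. X n s) \<longlonglongrightarrow> r s) \<Longrightarrow> (\<lambda>n. G t (X n)) \<longlonglongrightarrow> G t r"
    and super: "\<And>t. t \<in> T \<Longrightarrow> 0 < R t \<and> G t R \<le> c"
    and degenerate: "\<And>X m. (\<And>n s. s \<in> T \<Longrightarrow> 0 < X n s) \<Longrightarrow> (\<And>s. s \<in> T \<Longrightarrow> 0 \<le> m s) \<Longrightarrow>
        (\<And>s. s \<in> T \<Longrightarrow> (\<lambda>n. X n s) \<longlonglongrightarrow> m s) \<Longrightarrow> \<exists>s\<in>T. m s = 0 \<Longrightarrow> \<exists>n. \<exists>t\<in>T. c < G t (X n)"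
  shows "\<exists>r. \<forall>t\<in>T. 0 < r t \<and> G t r = c"
proof -
  define K where "K = {r. \<forall>t\<in>T. 0 < r t \<and> G t r \<le> c}"
  define m where "m t = (INF r\<in>K. r t)" for t
  have RK: "R \<in> K" using super by (simp add: K_def)
  have bdd: "bdd_below ((\<lambda>r. r t) ` K)" if "t \<in> T" for t
    using that by (intro bdd_belowI2[of _ 0]) (auto simp: K_def less_imp_le)
  have m_le: "m t \<le> r t" if "r \<in> K" "t \<in> T" for r t
    unfolding m_def using that bdd by (intro cINF_lower)
  have m_nonneg: "0 \<le> m t" if "t \<in> T" for t
    unfolding m_def using that RK by (intro cINF_greatest) (auto simp: K_def less_imp_le)
  have min_K: "(\<lambda>s. min (r s) (r' s)) \<in> K" if "r \<in> K" "r' \<in> K" for r r'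
  proof -
    have "G t (\<lambda>s. min (r s) (r' s)) \<le> c" if t: "t \<in> T" for t
    proof (cases "r t \<le> r' t")
      case True
      then have "G t (\<lambda>s. min (r s) (r' s)) \<le> G t r"
        using \<open>r \<in> K\<close> \<open>r' \<in> K\<close> t by (intro mono) (auto simp: K_def)
      then show ?thesis using \<open>r \<in> K\<close> t by (auto simp: K_def)
    next
      case False
      then have "G t (\<lambda>s. min (r s) (r' s)) \<le> G t r'"
        using \<open>r \<in> K\<close> \<open>r' \<in> K\<close> t by (intro mono) (auto simp: K_def)
      then show ?thesis using \<open>r' \<in> K\<close> t by (auto simp: K_def)
    qed
    then show ?thesis using that by (auto simp: K_def)
  qed
  have approx: "\<exists>r\<in>K. \<forall>t\<in>A. r t < m t + \<epsilon>" if "A \<subseteq> T" "\<epsilon> > 0" for A \<epsilon>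
    using finite_subset[OF \<open>A \<subseteq> T\<close> fin] \<open>A \<subseteq> T\<close>
  proof (induction A rule: finite_induct)
    case empty
    then show ?case using RK by blast
  next
    case (insert t A)
    then obtain r where r: "r \<in> K" "\<forall>t\<in>A. r t < m t + \<epsilon>" by auto
    have "\<exists>r'\<in>K. r' t < m t + \<epsilon>"
      using cINF_less_iff[of K "\<lambda>r. r t" "m t + \<epsilon>"] RK bdd insert.prems \<open>\<epsilon> > 0\<close>
      by (auto simp: m_def)
    then obtain r' where "r' \<in> K" "r' t < m t + \<epsilon>" by blast
    then show ?case using r min_K by (intro bexI[of _ "\<lambda>s. min (r s) (r' s)"]) auto
  qed
  have "\<forall>n. \<exists>r\<in>K. \<forall>t\<in>T. r t < m t + 1 / real (Suc n)" by (intro allI approx) auto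
  then obtain X where X: "\<And>n. X n \<in> K" "\<And>n t. t \<in> T \<Longrightarrow> X n t < m t + 1 / real (Suc n)"
    by metis
  have lim: "(\<lambda>n. X n t) \<longlonglongrightarrow> m t" if "t \<in> T" for t
  proof (rule tendsto_sandwich)
    show "\<forall>\<^sub>F n in sequentially. m t \<le> X n t" using m_le X that by simp
    show "\<forall>\<^sub>F n in sequentially. X n t \<le> m t + 1 / real (Suc n)"
      using X that by (simp add: less_imp_le)
    show "(\<lambda>n. m t + 1 / real (Suc n)) \<longlonglongrightarrow> m t"
      using LIMSEQ_inverse_real_of_nat_add[of "m t"] by (simp add: inverse_eq_divide)
  qed simp
  have "\<not> (\<exists>s\<in>T. m s = 0)"
  proof
    assume "\<exists>s\<in>T. m s = 0"
    then have "\<exists>n. \<exists>t\<in>T. c < G t (X n)"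
      using X(1) m_nonneg lim by (intro degenerate[of X m]) (auto simp: K_def)
    then obtain n t where "t \<in> T" "c < G t (X n)" by blast
    moreover have "G t (X n) \<le> c" using X(1)[of n] \<open>t \<in> T\<close> by (simp add: K_def)
    ultimately show False by simp
  qed
  then have m_pos: "0 < m t" if "t \<in> T" for t using m_nonneg that by (metis order_le_less)
  have G_le: "G t m \<le> c" if "t \<in> T" for t
    using cont[of t m X, OF that m_pos lim] X(1) that
    by (intro LIMSEQ_le_const2[of "\<lambda>n. G t (X n)"]) (auto simp: K_def)
  have "G t m = c" if t: "t \<in> T" for t
  proof (rule ccontr)
    assume "G t m \<noteq> c"
    then have lt: "G t m < c" using G_le[OF t] by simp
    \<comment> \<open>Decreasing \<open>m\<close> slightly at \<open>t\<close> alone would give smaller supersolutions.\<close>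
    define Y where "Y n = m(t := m t * (1 - 1 / real (n + 2)))" for n
    have Ypos: "0 < Y n s" "Y n s \<le> m s" if "s \<in> T" for n s
    proof -
      have "0 < 1 - 1 / real (n + 2)" "1 - 1 / real (n + 2) \<le> 1" by simp_all
      then show "0 < Y n s" "Y n s \<le> m s"
        using m_pos[OF that] by (auto simp: Y_def mult_le_cancel_left1 simp del: of_nat_add)
    qed
    have "(\<lambda>n. m t * (1 - 1 / real (n + 2))) \<longlonglongrightarrow> m t * (1 - 0)"
      by (intro tendsto_intros LIMSEQ_ignore_initial_segment[OF lim_1_over_n])
    then have "(\<lambda>n. Y n s) \<longlonglongrightarrow> m s" for s by (cases "s = t") (simp_all add: Y_def)
    then have "(\<lambda>n. G t (Y n)) \<longlonglongrightarrow> G t m" using t m_pos by (intro cont)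
    then have "\<forall>\<^sub>F n in sequentially. G t (Y n) < c" using lt by (rule order_tendstoD)
    then obtain n where n: "G t (Y n) < c" by (meson eventually_happens trivial_limit_sequentially)
    have "G s (Y n) \<le> c" if s: "s \<in> T" for s
    proof (cases "s = t")
      case False
      then have "G s (Y n) \<le> G s m" using s Ypos by (intro mono) (auto simp: Y_def)
      then show ?thesis using G_le[OF s] by simp
    qed (use n in simp)
    then have "Y n \<in> K" using Ypos by (simp add: K_def)
    then have "m t \<le> Y n t" using t by (rule m_le)
    then show False using m_pos[OF t] by (simp add: Y_def field_simps)
  qed
  then show ?thesis using m_pos by blast
qed

lemma slots_mono: "S \<subseteq> T \<Longrightarrow> slots S \<subseteq> slots T"
  by (auto simp: slots_def)

text \<open>
  Here \<open>\<sigma>\<close> glues the sides in pairs, and a side may be glued to itself; \<open>\<omega>\<close> is the angle between the radii at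
  the ends of the glued side. The equation at \<open>t\<close> says that the central angles in the circle around \<open>t\<close>
  fill it exactly once. For radii that degenerate to zero on a set \<open>S\<close> of triangles, the sum of the left
  sides over \<open>S\<close> tends to the right side of the last hypothesis, which is too large for a limit of
  supersolutions.
\<close>
lemma circumradii_exist:
  fixes T :: "'t set" and \<sigma> :: "'t \<times> 3 \<Rightarrow> 't \<times> 3" and \<omega> :: "'t \<times> 3 \<Rightarrow> real"
  assumes fin: "finite T"
    and \<sigma>: "\<And>s. s \<in> slots T \<Longrightarrow> \<sigma> s \<in> slots T \<and> \<sigma> (\<sigma> s) = s"
    and \<omega>: "\<And>s. s \<in> slots T \<Longrightarrow> 0 < \<omega> s \<and> \<omega> s < pi \<and> \<omega> (\<sigma> s) = \<omega> s"
    and hall: "\<And>S. S \<subseteq> T \<Longrightarrow> S \<noteq> {} \<Longrightarrow>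
        pi * real (card S) < (\<Sum>s\<in>slots S \<union> \<sigma> ` slots S. (pi - \<omega> s) / 2)"
  shows "\<exists>r. \<forall>t\<in>T. 0 < r t \<and>
           (\<Sum>i\<in>UNIV. half_central_angle (r t) (r (fst (\<sigma> (t, i)))) (\<omega> (t, i))) = pi"
proof -
  define H where "H r s = half_central_angle (r (fst s)) (r (fst (\<sigma> s))) (\<omega> s)" for r s
  define G where "G t r = (\<Sum>i\<in>UNIV. H r (t, i))" for t r
  have slot: "(t, i) \<in> slots T" "fst (\<sigma> (t, i)) \<in> T" if "t \<in> T" for t i
    using that \<sigma>[of "(t, i)"] by (auto simp: slots_def)
  have "\<exists>r. \<forall>t\<in>T. 0 < r t \<and> G t r = pi"
  proof -
    \<comment> \<open>A constant supersolution: large circles of equal size see every common chord under a small angle.\<close>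
    have "\<forall>\<^sub>F x in at_top. 0 < x \<and> (\<forall>s\<in>slots T. half_central_angle x x (\<omega> s) < pi / 3)"
    proof (intro eventually_conj eventually_ball_finite ballI)
      show "finite (slots T)" using fin by (simp add: slots_def)
      show "\<forall>\<^sub>F x::real in at_top. 0 < x" by (rule eventually_gt_at_top)
      fix s assume "s \<in> slots T"
      then have s: "sin (\<omega> s) > 0" "cos (\<omega> s) < 1"
        using \<omega>[of s] cos_monotone_0_pi[of 0 "\<omega> s"] by (auto simp: sin_gt_zero)
      define k where "k = (1 - cos (\<omega> s)) / sin (\<omega> s)"
      have "k > 0" using s by (simp add: k_def)
      then have "filterlim (\<lambda>x::real. cosh x * k) at_top at_top"
        by (intro filterlim_at_top_mult_tendsto_pos[OF tendsto_const _ cosh_real_at_top])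
      then have "((\<lambda>x. arctan (cosh x * k)) \<longlongrightarrow> pi / 2) at_top"
        by (rule filterlim_compose[OF tendsto_arctan_at_top])
      then have "\<forall>\<^sub>F x in at_top. pi / 6 < arctan (cosh x * k)"
        by (rule order_tendstoD) simp
      then show "\<forall>\<^sub>F x in at_top. half_central_angle x x (\<omega> s) < pi / 3"
        using eventually_gt_at_top[of "0::real"]
        by eventually_elim (simp add: half_central_angle_def base_tan_def k_def)
    qed
    then obtain x where x: "0 < x" "\<And>s. s \<in> slots T \<Longrightarrow> half_central_angle x x (\<omega> s) < pi / 3"
      by (metis (no_types, lifting) eventually_happens trivial_limit_at_top_linorder)
    show ?thesis
    proof (rule minimal_supersolution[OF fin, where R = "\<lambda>_. x"])
      fix t and r r' :: "'t \<Rightarrow> real"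
      assume t: "t \<in> T" and r: "\<And>s. s \<in> T \<Longrightarrow> 0 < r s \<and> r s \<le> r' s" "r t = r' t"
      have "H r (t, i) \<le> H r' (t, i)" for i
        using half_central_angle_mono[of "r t" "r (fst (\<sigma> (t, i)))" "r' (fst (\<sigma> (t, i)))" "\<omega> (t, i)"]
          r(1)[OF t] r(1)[OF slot(2)[OF t], of i] r(2) \<omega>[OF slot(1)[OF t], of i]
        by (simp add: H_def)
      then show "G t r \<le> G t r'" unfolding G_def by (intro sum_mono)
    next
      fix t X and r :: "'t \<Rightarrow> real"
      assume t: "t \<in> T" and pos: "\<And>s. s \<in> T \<Longrightarrow> 0 < r s"
        and lim: "\<And>s. s \<in> T \<Longrightarrow> (\<lambda>n. X n s) \<longlonglongrightarrow> r s"
      have "(\<lambda>n. H (X n) (t, i)) \<longlonglongrightarrow> H r (t, i)" for i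
      proof -
        have "sin (\<omega> (t, i)) \<noteq> 0" using \<omega>[OF slot(1)[OF t], of i] sin_gt_zero by fastforce
        moreover have "tanh (r (fst (\<sigma> (t, i)))) \<noteq> 0" using pos[OF slot(2)[OF t], of i] by simp
        ultimately show ?thesis
          unfolding H_def half_central_angle_def base_tan_def fst_conv
          using lim[OF t] lim[OF slot(2)[OF t], of i] by (intro tendsto_intros) auto
      qed
      then show "(\<lambda>n. G t (X n)) \<longlonglongrightarrow> G t r" unfolding G_def by (intro tendsto_sum)
    next
      fix t assume t: "t \<in> T"
      have "G t (\<lambda>_. x) \<le> (\<Sum>i\<in>(UNIV :: 3 set). pi / 3)"
        unfolding G_def H_def using x(2) slot[OF t] by (intro sum_mono) (auto simp: less_imp_le)
      then show "0 < x \<and> G t (\<lambda>_. x) \<le> pi" using x(1) by simp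
    next
      fix X and m :: "'t \<Rightarrow> real"
      assume X: "\<And>n s. s \<in> T \<Longrightarrow> 0 < X n s" and m: "\<And>s. s \<in> T \<Longrightarrow> 0 \<le> m s"
        and lim: "\<And>s. s \<in> T \<Longrightarrow> (\<lambda>n. X n s) \<longlonglongrightarrow> m s" and "\<exists>s\<in>T. m s = 0"
      define S where "S = {s \<in> T. m s = 0}"
      have S: "S \<subseteq> T" "S \<noteq> {}" "finite S" using \<open>\<exists>s\<in>T. m s = 0\<close> fin by (auto simp: S_def)
      have sl: "slots S \<subseteq> slots T" using S(1) by (rule slots_mono)
      have finS: "finite (slots S)" using S by (simp add: slots_def)
      \<comment> \<open>Sides in \<open>A\<close> are glued within \<open>S\<close>, and their contributions are exact in pairs. Sides in \<open>B\<close> face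
          a circle that does not shrink, and a single side collects the weight of both.\<close>
      define A where "A = {s \<in> slots S. \<sigma> s \<in> slots S}"
      define B where "B = slots S - A"
      define h where "h n s = pi / 2 - arctan (base_tan (X n (fst s)) (X n (fst (\<sigma> s))) (\<omega> s))" for n s
      have \<sigma>S: "\<sigma> s \<in> slots T" "\<sigma> (\<sigma> s) = s" "0 < \<omega> s" "\<omega> s < pi" "\<omega> (\<sigma> s) = \<omega> s" if "s \<in> slots S" for s
        using \<sigma> \<omega> sl that by blast+
      have inj: "inj_on \<sigma> (slots S)" by (rule inj_on_inverseI[of _ \<sigma>]) (rule \<sigma>S)
      have \<sigma>A: "\<sigma> ` A = A"
      proof
        show "\<sigma> ` A \<subseteq> A" using \<sigma>S by (auto simp: A_def)
        then show "A \<subseteq> \<sigma> ` A" using \<sigma>S unfolding A_def by (auto intro: rev_image_eqI)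
      qed
      have sumA: "(\<Sum>s\<in>A. h n s) = (\<Sum>s\<in>A. (pi - \<omega> s) / 2)" for n
      proof -
        have "(\<Sum>s\<in>A. h n s) = (\<Sum>s\<in>A. h n (\<sigma> s))"
          using sum.reindex[of \<sigma> A "h n"] inj_on_subset[OF inj, of A] \<sigma>A by (auto simp: A_def o_def)
        then have "2 * (\<Sum>s\<in>A. h n s) = (\<Sum>s\<in>A. h n s + h n (\<sigma> s))"
          by (simp add: sum.distrib)
        also have "\<dots> = (\<Sum>s\<in>A. pi - \<omega> s)"
        proof (rule sum.cong[OF refl])
          fix s assume "s \<in> A"
          then have s: "s \<in> slots S" "\<sigma> s \<in> slots S" by (auto simp: A_def)
          then have "fst s \<in> T" "fst (\<sigma> s) \<in> T" using S by (auto simp: slots_def)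
          then show "h n s + h n (\<sigma> s) = pi - \<omega> s"
            using base_angles_sum[of "X n (fst s)" "X n (fst (\<sigma> s))" "\<omega> s"] X \<sigma>S[OF s(1)]
            by (simp add: h_def)
        qed
        finally show ?thesis by (simp flip: sum_divide_distrib)
      qed
      have limB: "(\<lambda>n. h n s) \<longlonglongrightarrow> (pi - \<omega> s) / 2 + (pi - \<omega> (\<sigma> s)) / 2" if "s \<in> B" for s
      proof -
        have s: "s \<in> slots S" "\<sigma> s \<notin> slots S" using that by (auto simp: A_def B_def)
        then have T: "fst s \<in> T" "m (fst s) = 0" "fst (\<sigma> s) \<in> T" "m (fst (\<sigma> s)) > 0"
          using m[of "fst (\<sigma> s)"] \<sigma>S(1)[OF s(1)] by (auto simp: slots_def S_def)
        have "(\<lambda>n. h n s) \<longlonglongrightarrow> pi / 2 - (\<omega> s - pi / 2)"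
          unfolding h_def using lim[OF T(1)] lim[OF T(3)] T \<sigma>S[OF s(1)]
          by (intro tendsto_diff tendsto_const tendsto_base_angle_zero[where m = "m (fst (\<sigma> s))"]) auto
        also have "pi / 2 - (\<omega> s - pi / 2) = (pi - \<omega> s) / 2 + (pi - \<omega> (\<sigma> s)) / 2"
          using \<sigma>S(5)[OF s(1)] by (simp add: field_simps)
        finally show ?thesis .
      qed
      have disj: "slots S \<union> \<sigma> ` slots S = A \<union> (B \<union> \<sigma> ` B)" "A \<inter> (B \<union> \<sigma> ` B) = {}" "B \<inter> \<sigma> ` B = {}"
        "finite A" "finite B" "slots S = A \<union> B" "A \<inter> B = {}"
        using \<sigma>A \<sigma>S finS by (auto simp: A_def B_def)
      have "(\<Sum>s\<in>slots S \<union> \<sigma> ` slots S. (pi - \<omega> s) / 2)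
          = (\<Sum>s\<in>A. (pi - \<omega> s) / 2) + (\<Sum>s\<in>B. (pi - \<omega> s) / 2 + (pi - \<omega> (\<sigma> s)) / 2)"
      proof -
        have "inj_on \<sigma> B" using inj_on_subset[OF inj, of B] by (simp add: B_def)
        then have "(\<Sum>s\<in>\<sigma> ` B. (pi - \<omega> s) / 2) = (\<Sum>s\<in>B. (pi - \<omega> (\<sigma> s)) / 2)"
          by (simp add: sum.reindex)
        moreover have "(\<Sum>s\<in>A \<union> (B \<union> \<sigma> ` B). (pi - \<omega> s) / 2)
            = (\<Sum>s\<in>A. (pi - \<omega> s) / 2) + (\<Sum>s\<in>B \<union> \<sigma> ` B. (pi - \<omega> s) / 2)"
          by (rule sum.union_disjoint) (use disj in auto)
        moreover have "(\<Sum>s\<in>B \<union> \<sigma> ` B. (pi - \<omega> s) / 2)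
            = (\<Sum>s\<in>B. (pi - \<omega> s) / 2) + (\<Sum>s\<in>\<sigma> ` B. (pi - \<omega> s) / 2)"
          by (rule sum.union_disjoint) (use disj in auto)
        ultimately show ?thesis unfolding disj(1) by (simp only: sum.distrib)
      qed
      moreover have "(\<lambda>n. (\<Sum>s\<in>A. h n s) + (\<Sum>s\<in>B. h n s)) \<longlonglongrightarrow>
          (\<Sum>s\<in>A. (pi - \<omega> s) / 2) + (\<Sum>s\<in>B. (pi - \<omega> s) / 2 + (pi - \<omega> (\<sigma> s)) / 2)"
        unfolding sumA by (intro tendsto_add tendsto_const tendsto_sum limB)
      ultimately have lim_AB: "(\<lambda>n. (\<Sum>s\<in>A. h n s) + (\<Sum>s\<in>B. h n s)) \<longlonglongrightarrow>
          (\<Sum>s\<in>slots S \<union> \<sigma> ` slots S. (pi - \<omega> s) / 2)"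
        by (simp only:)
      then have lim_h: "(\<lambda>n. \<Sum>s\<in>slots S. h n s) \<longlonglongrightarrow> (\<Sum>s\<in>slots S \<union> \<sigma> ` slots S. (pi - \<omega> s) / 2)"
      proof -
        have "(\<Sum>s\<in>slots S. h n s) = (\<Sum>s\<in>A. h n s) + (\<Sum>s\<in>B. h n s)" for n
          unfolding disj(6) by (rule sum.union_disjoint[OF disj(4,5,7)])
        then show ?thesis
          using lim_AB by (simp only:)
      qed
      have "(\<lambda>n. (cosh (X n (fst s)) - 1) / 2) \<longlonglongrightarrow> (cosh 0 - 1) / 2" if "s \<in> slots S" for s
        using lim[of "fst s"] that by (intro tendsto_intros) (auto simp: slots_def S_def)
      then have "(\<lambda>n. \<Sum>s\<in>slots S. (cosh (X n (fst s)) - 1) / 2) \<longlonglongrightarrow> (\<Sum>s\<in>slots S. 0)"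
        by (intro tendsto_sum) simp
      from tendsto_diff[OF lim_h this]
      have "(\<lambda>n. \<Sum>s\<in>slots S. h n s - (cosh (X n (fst s)) - 1) / 2)
          \<longlonglongrightarrow> (\<Sum>s\<in>slots S \<union> \<sigma> ` slots S. (pi - \<omega> s) / 2)"
        by (simp add: sum_subtractf)
      then have "\<forall>\<^sub>F n in sequentially. pi * real (card S) < (\<Sum>s\<in>slots S. h n s - (cosh (X n (fst s)) - 1) / 2)"
        using hall[OF S(1,2)] by (rule order_tendstoD)
      then obtain n where n: "pi * real (card S) < (\<Sum>s\<in>slots S. h n s - (cosh (X n (fst s)) - 1) / 2)"
        by (meson eventually_happens trivial_limit_sequentially)
      also have "\<dots> \<le> (\<Sum>s\<in>slots S. H (X n) s)"
        unfolding h_def H_def by (intro sum_mono half_central_angle_ge)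
      also have "\<dots> = (\<Sum>t\<in>S. G t (X n))"
        by (simp add: slots_def G_def sum.cartesian_product)
      finally have "\<not> (\<Sum>t\<in>S. G t (X n)) \<le> (\<Sum>t\<in>S. pi)" by (simp add: mult.commute)
      then have "\<exists>t\<in>S. pi < G t (X n)" using sum_mono[of S "\<lambda>t. G t (X n)" "\<lambda>_. pi"] by force
      then show "\<exists>n. \<exists>t\<in>T. pi < G t (X n)" using S by blast
    qed
  qed
  then show ?thesis by (simp add: G_def H_def)
qed

section \<open>Corners and edges of the decomposition\<close>

lemma UNIV_3_cyclic: "(UNIV :: 3 set) = {i, i + 1, i + 2}"
  and cyclic_3_distinct: "i \<noteq> i + 1" "i \<noteq> i + 2" "i + 1 \<noteq> i + (2 :: 3)"
  and cyclic_3_add: "i + 1 + 1 = i + (2 :: 3)" "i + 1 + 2 = i" "i + 2 + 1 = i" "i + 2 + 2 = i + 1"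
proof -
  show d: "i \<noteq> i + 1" "i \<noteq> i + 2" "i + 1 \<noteq> i + (2 :: 3)" by simp_all
  have "card {i, i + 1, i + 2} = CARD(3)" using d by (simp)
  then show "(UNIV :: 3 set) = {i, i + 1, i + 2}"
    by (metis card_subset_eq finite subset_UNIV)
  show "i + 1 + 1 = i + (2 :: 3)" "i + 1 + 2 = i" "i + 2 + 1 = i" "i + 2 + 2 = i + 1"
    by (simp_all add: add.assoc)
qed

lemma sum_3_cyclic: "(\<Sum>j\<in>UNIV. f j) = f i + f (i + 1) + f (i + (2 :: 3))"
  for f :: "3 \<Rightarrow> 'a::comm_monoid_add"
  unfolding UNIV_3_cyclic[of i] using cyclic_3_distinct[of i] by (simp add: add.assoc)

lemma corner_distinct: "corner i = corner j \<longleftrightarrow> i = j"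
  by (simp add: corner_def axis_eq_axis)

lemma open_side_segment: "open_side i = open_segment (corner (i + 1)) (corner (i + 2))"
proof
  note d = cyclic_3_distinct[of i]
  show "open_side i \<subseteq> open_segment (corner (i + 1)) (corner (i + 2))"
  proof
    fix x assume x: "x \<in> open_side i"
    have s: "x $ i = 0" "x $ (i + 1) > 0" "x $ (i + 2) > 0" "x $ (i + 1) + x $ (i + 2) = 1"
      using x d sum_3_cyclic[of "\<lambda>j. x $ j" i] by (auto simp: open_side_def std_simplex_def)
    have "x $ j = ((1 - x $ (i + 2)) *\<^sub>R corner (i + 1) + (x $ (i + 2)) *\<^sub>R corner (i + 2)) $ j" for j
    proof -
      have "j \<in> {i, i + 1, i + 2}" using UNIV_3_cyclic[of i] by blast
      then show ?thesis using s d by (auto simp: corner_def axis_def)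
    qed
    then have "x = (1 - x $ (i + 2)) *\<^sub>R corner (i + 1) + (x $ (i + 2)) *\<^sub>R corner (i + 2)"
      unfolding vec_eq_iff by blast
    moreover have "x $ (i + 2) < 1" using s by linarith
    ultimately show "x \<in> open_segment (corner (i + 1)) (corner (i + 2))"
      unfolding in_segment corner_distinct using s d by blast
  qed
  show "open_segment (corner (i + 1)) (corner (i + 2)) \<subseteq> open_side i"
  proof
    fix x assume "x \<in> open_segment (corner (i + 1)) (corner (i + 2))"
    then obtain a where a: "0 < a" "a < 1" and x: "x = (1 - a) *\<^sub>R corner (i + 1) + a *\<^sub>R corner (i + 2)"
      by (subst (asm) in_segment) auto
    have c: "x $ i = 0" "x $ (i + 1) = 1 - a" "x $ (i + 2) = a"
      using d by (auto simp: x corner_def axis_def)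
    have "0 \<le> x $ j" "j \<noteq> i \<Longrightarrow> 0 < x $ j" for j
    proof -
      have "j \<in> {i, i + 1, i + 2}" using UNIV_3_cyclic[of i] by blast
      then show "0 \<le> x $ j" "j \<noteq> i \<Longrightarrow> 0 < x $ j" using c a by auto
    qed
    moreover have "(\<Sum>j\<in>UNIV. x $ j) = 1"
      unfolding sum_3_cyclic[of _ i] using c by simp
    ultimately show "x \<in> open_side i"
      using c(1) by (simp add: open_side_def std_simplex_def)
  qed
qed

lemma corner_in_std_simplex: "corner i \<in> std_simplex"
  by (auto simp: corner_def std_simplex_def axis_def)

lemma corner_notin_open_side: "corner i \<notin> open_side j"
proof
  assume "corner i \<in> open_side j"
  then have "k \<noteq> j \<Longrightarrow> k = i" for k
    by (auto simp: open_side_def corner_def axis_def split: if_splits)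
  from this[of "j + 1"] this[of "j + 2"] show False
    using cyclic_3_distinct[of j] by metis
qed

text \<open>
  The closed side is compact, so the closure of the open edge is the image of the closed side. A
  corner is not mapped into an open edge, because points that share their image with a point of an open
  side lie on open sides themselves.
\<close>
lemma endpoints_edge_at:
  assumes cd: "cell_decomposition M T \<phi>" and t: "t \<in> T"
  shows "endpoints (edge_at \<phi> (t, i)) = {vertex_at \<phi> (t, i + 1), vertex_at \<phi> (t, i + 2)}"
proof -
  let ?a = "corner (i + 1)" and ?b = "corner (i + 2)"
  have ab: "?a \<noteq> ?b" using cyclic_3_distinct[of i] by (simp add: corner_distinct)
  have cont: "continuous_on std_simplex (\<phi> t)" using cd t by (simp add: cell_decomposition_def)
  have conv: "closed_segment ?a ?b \<subseteq> std_simplex"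
  proof -
    have "convex std_simplex"
      unfolding convex_def std_simplex_def
      by (auto simp: sum.distrib simp flip: sum_distrib_left)
    then show ?thesis by (simp add: closed_segment_subset corner_in_std_simplex)
  qed
  have cont': "continuous_on (closed_segment ?a ?b) (\<phi> t)"
    using continuous_on_subset[OF cont conv] .
  have os: "open_side i = open_segment ?a ?b" by (rule open_side_segment)
  have "compact (\<phi> t ` closed_segment ?a ?b)"
    using cont' by (simp add: compact_continuous_image)
  then have "closure (\<phi> t ` open_segment ?a ?b) \<subseteq> \<phi> t ` closed_segment ?a ?b"
    by (intro closure_minimal image_mono segment_open_subset_closed compact_imp_closed)
  moreover have "\<phi> t ` closed_segment ?a ?b \<subseteq> closure (\<phi> t ` open_segment ?a ?b)"
    using image_closure_subset[of "open_segment ?a ?b" "\<phi> t" "closure (\<phi> t ` open_segment ?a ?b)"]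
      cont' ab by (simp add: closure_open_segment closure_subset)
  moreover have "closed_segment ?a ?b = open_segment ?a ?b \<union> {?a, ?b}"
    by (simp add: closed_segment_eq_open)
  ultimately have cl: "closure (edge_at \<phi> (t, i)) = edge_at \<phi> (t, i) \<union> {\<phi> t ?a, \<phi> t ?b}"
    by (auto simp: edge_at_def os)
  have "\<phi> t (corner j) \<notin> edge_at \<phi> (t, i)" for j
  proof
    assume "\<phi> t (corner j) \<in> edge_at \<phi> (t, i)"
    then obtain x where x: "x \<in> open_side i" "\<phi> t x = \<phi> t (corner j)"
      by (auto simp: edge_at_def)
    have "\<forall>x\<in>open_side i. \<forall>y\<in>std_simplex. \<phi> t x = \<phi> t y \<longrightarrow> (\<exists>j. y \<in> open_side j)"
      using cd t unfolding cell_decomposition_def by metis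
    then have "\<exists>k. corner j \<in> open_side k"
      using x corner_in_std_simplex by blast
    then show False using corner_notin_open_side by blast
  qed
  then show ?thesis unfolding endpoints_def cl by (auto simp: vertex_at_def)
qed

lemma end_mult_edge_at:
  assumes "cell_decomposition M T \<phi>" and "t \<in> T"
  shows "real (end_mult v (edge_at \<phi> (t, i)))
     = of_bool (vertex_at \<phi> (t, i + 1) = v) + of_bool (vertex_at \<phi> (t, i + 2) = v)"
  unfolding end_mult_def endpoints_edge_at[OF assms] by auto

lemma sum_over_sides:
  fixes g :: "'t \<times> 3 \<Rightarrow> real"
  assumes "finite T"
  shows "(\<Sum>e\<in>edges T \<phi>. \<Sum>s\<in>sides_of T \<phi> e. g s) = (\<Sum>s\<in>slots T. g s)"
  unfolding edges_def sides_of_def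
  by (rule sum.group) (use assms in \<open>auto simp: slots_def\<close>)

text \<open>
  The angle at a corner is the sum of the base angles \<^const>\<open>side_psi\<close> of the two sides that meet there.
  Summing over the corners at \<open>v\<close> therefore counts every side once for each of its ends at \<open>v\<close>. In this
  way the conditions on \<open>p\<close> at the vertices become those on the vertex angles.
\<close>
lemma vertex_angle_sum_eq:
  fixes x :: "'t \<times> 3 \<Rightarrow> real"
  assumes cd: "cell_decomposition M T \<phi>"
  shows "vertex_angle_sum T \<phi> v x = (\<Sum>e\<in>edges T \<phi>. real (end_mult v e) * Psi T \<phi> x e)"
proof -
  have fin: "finite T" using cd by (simp add: cell_decomposition_def)
  have "(\<Sum>e\<in>edges T \<phi>. real (end_mult v e) * Psi T \<phi> x e)
      = (\<Sum>e\<in>edges T \<phi>. \<Sum>s\<in>sides_of T \<phi> e. real (end_mult v (edge_at \<phi> s)) * side_psi x s)"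
    by (auto simp: Psi_def sum_distrib_left sides_of_def intro!: sum.cong)
  also have "\<dots> = (\<Sum>s\<in>slots T. real (end_mult v (edge_at \<phi> s)) * side_psi x s)"
    by (rule sum_over_sides[OF fin])
  also have "\<dots> = (\<Sum>t\<in>T. \<Sum>i\<in>UNIV. real (end_mult v (edge_at \<phi> (t, i))) * side_psi x (t, i))"
    by (simp add: slots_def sum.cartesian_product case_prod_unfold)
  also have "\<dots> = (\<Sum>t\<in>T. \<Sum>i\<in>UNIV. of_bool (vertex_at \<phi> (t, i) = v) * x (t, i))"
  proof (rule sum.cong[OF refl])
    fix t assume t: "t \<in> T"
    fix i :: 3
    show "(\<Sum>i\<in>UNIV. real (end_mult v (edge_at \<phi> (t, i))) * side_psi x (t, i))
        = (\<Sum>i\<in>UNIV. of_bool (vertex_at \<phi> (t, i) = v) * x (t, i))"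
    proof -
      define m where "m i = real (of_bool (vertex_at \<phi> (t, i) = v))" for i
      have mult: "real (end_mult v (edge_at \<phi> (t, i))) = m (i + 1) + m (i + 2)" for i
        using end_mult_edge_at[OF cd t, of v i] by (simp add: m_def)
      have "(\<Sum>i\<in>UNIV. real (end_mult v (edge_at \<phi> (t, i))) * side_psi x (t, i))
          = (\<Sum>i\<in>UNIV. m i * x (t, i))"
        unfolding mult sum_3_cyclic[of _ i] side_psi_def prod.case cyclic_3_add
        by (simp add: field_simps)
      then show ?thesis by (simp add: m_def)
    qed
  qed
  also have "\<dots> = (\<Sum>s\<in>slots T. of_bool (vertex_at \<phi> s = v) * x s)"
    unfolding sum.cartesian_product slots_def by (intro sum.cong) auto
  also have "\<dots> = vertex_angle_sum T \<phi> v x"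
    unfolding vertex_angle_sum_def using fin
    by (intro sum.mono_neutral_cong_right) (auto simp: slots_def)
  finally show ?thesis by simp
qed

section \<open>Construction of the uniform angle system\<close>

lemma opposite_sides:
  assumes cd: "cell_decomposition M T \<phi>"
  shows "\<exists>\<sigma>. \<forall>s\<in>slots T. sides_of T \<phi> (edge_at \<phi> s) = {s, \<sigma> s} \<and>
           (\<sigma> s = s \<longleftrightarrow> edge_at \<phi> s \<in> boundary_edges M T \<phi>)"
proof -
  have "\<exists>s'. sides_of T \<phi> (edge_at \<phi> s) = {s, s'} \<and> (s' = s \<longleftrightarrow> edge_at \<phi> s \<in> boundary_edges M T \<phi>)"
    if s: "s \<in> slots T" for s
  proof -
    have c: "card (sides_of T \<phi> (edge_at \<phi> s)) = (if edge_at \<phi> s \<in> boundary_edges M T \<phi> then 1 else 2)"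
      using cd s by (simp add: cell_decomposition_def edges_def)
    have mem: "s \<in> sides_of T \<phi> (edge_at \<phi> s)" using s by (simp add: sides_of_def)
    show ?thesis
    proof (cases "edge_at \<phi> s \<in> boundary_edges M T \<phi>")
      case True
      then have "sides_of T \<phi> (edge_at \<phi> s) = {s}" using c mem by (auto simp: card_1_singleton_iff)
      then show ?thesis using True by auto
    next
      case False
      then obtain a b where ab: "sides_of T \<phi> (edge_at \<phi> s) = {a, b}" "a \<noteq> b"
        using c by (auto simp: card_2_iff)
      then consider "s = a" | "s = b" using mem by blast
      then show ?thesis
      proof cases
        case 1
        then show ?thesis using ab False by (intro exI[of _ b]) simp
      next
        case 2
        then show ?thesis using ab False by (intro exI[of _ a]) (simp add: insert_commute)
      qed
    qed
  qed
  then show ?thesis by (intro bchoice ballI)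
qed

text \<open>
  The radii \<open>r\<close> of the circumscribed circles and the tangents \<open>w\<close> of the base angles. A boundary edge is
  regarded as glued to itself with twice its angle: both circles then coincide, the base angle is half of
  \<open>\<omega> = 2 p e\<close>, and the weight \<open>(\<pi> - \<omega>) / 2\<close> of its only side is \<open>\<theta>\<close>. For an interior edge
  the weights of its two sides add up to \<open>\<theta>\<close>.
\<close>
lemma circle_pattern_exists:
  assumes cd: "cell_decomposition M T \<phi>"
    and interior: "\<forall>e\<in>edges T \<phi> - boundary_edges M T \<phi>. 0 < p e \<and> p e < pi"
    and boundary: "\<forall>e\<in>boundary_edges M T \<phi>. 0 < p e \<and> p e < pi / 2"
    and hall: "\<forall>S. S \<subseteq> T \<longrightarrow> S \<noteq> {} \<longrightarrow>
           (\<Sum>e\<in>edges S \<phi>. theta M T \<phi> p e) > pi * real (card S)"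
  shows "\<exists>r w. (\<forall>t\<in>T. 0 < r t \<and> (\<Sum>i\<in>UNIV. pi / 2 - arctan (cosh (r t) * w (t, i))) = pi) \<and>
    (\<forall>e\<in>edges T \<phi>. (\<Sum>s\<in>sides_of T \<phi> e. arctan (w s)) = p e \<and>
      (\<forall>s\<in>sides_of T \<phi> e. \<forall>s'\<in>sides_of T \<phi> e.
         (sinh (r (fst s)))\<^sup>2 / (1 + (cosh (r (fst s)) * w s)\<^sup>2)
           = (sinh (r (fst s')))\<^sup>2 / (1 + (cosh (r (fst s')) * w s')\<^sup>2)))"
proof -
  have fin: "finite T" using cd by (simp add: cell_decomposition_def)
  obtain \<sigma> where \<sigma>: "\<And>s. s \<in> slots T \<Longrightarrow> sides_of T \<phi> (edge_at \<phi> s) = {s, \<sigma> s}"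
    "\<And>s. s \<in> slots T \<Longrightarrow> \<sigma> s = s \<longleftrightarrow> edge_at \<phi> s \<in> boundary_edges M T \<phi>"
    using opposite_sides[OF cd] by blast
  have \<sigma>T: "\<sigma> s \<in> slots T" "edge_at \<phi> (\<sigma> s) = edge_at \<phi> s" if "s \<in> slots T" for s
    using \<sigma>(1)[OF that] by (auto simp: sides_of_def)
  have \<sigma>\<sigma>: "\<sigma> (\<sigma> s) = s" if "s \<in> slots T" for s
  proof -
    have "{\<sigma> s, \<sigma> (\<sigma> s)} = {s, \<sigma> s}"
      using \<sigma>(1)[OF that] \<sigma>(1)[OF \<sigma>T(1)[OF that]] \<sigma>T(2)[OF that] by simp
    then show ?thesis by (metis doubleton_eq_iff)
  qed
  define \<omega> where "\<omega> s = (if edge_at \<phi> s \<in> boundary_edges M T \<phi> then 2 else 1) * p (edge_at \<phi> s)" for s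
  have edge: "edge_at \<phi> s \<in> edges T \<phi>" if "s \<in> slots T" for s using that by (simp add: edges_def)
  have \<omega>: "0 < \<omega> s" "\<omega> s < pi" "\<omega> (\<sigma> s) = \<omega> s" if s: "s \<in> slots T" for s
    using bspec[OF interior, of "edge_at \<phi> s"] bspec[OF boundary, of "edge_at \<phi> s"] edge[OF s] \<sigma>T(2)[OF s]
    by (auto simp: \<omega>_def)
  have theta: "(\<Sum>s\<in>sides_of T \<phi> e. (pi - \<omega> s) / 2) = theta M T \<phi> p e" if "e \<in> edges T \<phi>" for e
  proof -
    obtain s where s: "s \<in> slots T" "e = edge_at \<phi> s" using \<open>e \<in> edges T \<phi>\<close> unfolding edges_def by blast
    show ?thesis
      using \<sigma>[OF s(1)] \<sigma>T[OF s(1)]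
      by (cases "\<sigma> s = s") (auto simp: s(2) theta_def \<omega>_def field_simps)
  qed
  have "pi * real (card S) < (\<Sum>s\<in>slots S \<union> \<sigma> ` slots S. (pi - \<omega> s) / 2)"
    if S: "S \<subseteq> T" "S \<noteq> {}" for S
  proof -
    have sub: "slots S \<subseteq> slots T" using S by (auto simp: slots_def)
    have eS: "edges S \<phi> \<subseteq> edges T \<phi>" using sub by (auto simp: edges_def)
    have finS: "finite (slots S)" using finite_subset[OF S(1) fin] by (simp add: slots_def)
    have un: "{s \<in> slots S \<union> \<sigma> ` slots S. edge_at \<phi> s = e} = sides_of T \<phi> e" if "e \<in> edges S \<phi>" for e
    proof -
      obtain s where s: "s \<in> slots S" "e = edge_at \<phi> s" using \<open>e \<in> edges S \<phi>\<close> unfolding edges_def by blast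
      then have e: "sides_of T \<phi> e = {s, \<sigma> s}" using \<sigma>(1) sub by blast
      show ?thesis
      proof
        show "{s \<in> slots S \<union> \<sigma> ` slots S. edge_at \<phi> s = e} \<subseteq> sides_of T \<phi> e"
          using sub \<sigma>T(1) by (auto simp: sides_of_def)
        show "sides_of T \<phi> e \<subseteq> {s \<in> slots S \<union> \<sigma> ` slots S. edge_at \<phi> s = e}"
          unfolding e using s \<sigma>T(2)[of s] sub by auto
      qed
    qed
    have "(\<Sum>e\<in>edges S \<phi>. theta M T \<phi> p e)
        = (\<Sum>e\<in>edges S \<phi>. \<Sum>s\<in>{s \<in> slots S \<union> \<sigma> ` slots S. edge_at \<phi> s = e}. (pi - \<omega> s) / 2)"
      using theta eS un by (intro sum.cong) auto
    also have "\<dots> = (\<Sum>s\<in>slots S \<union> \<sigma> ` slots S. (pi - \<omega> s) / 2)"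
      using finS sub \<sigma>T(2) by (intro sum.group) (auto simp: edges_def)
    finally show ?thesis using hall[rule_format, OF S] by simp
  qed
  then have "\<exists>r. \<forall>t\<in>T. 0 < r t \<and>
      (\<Sum>i\<in>UNIV. half_central_angle (r t) (r (fst (\<sigma> (t, i)))) (\<omega> (t, i))) = pi"
    using \<sigma>T(1) \<sigma>\<sigma> \<omega> by (intro circumradii_exist[OF fin]) simp_all
  then obtain r where r: "\<And>t. t \<in> T \<Longrightarrow> 0 < r t" "\<And>t. t \<in> T \<Longrightarrow>
      (\<Sum>i\<in>UNIV. half_central_angle (r t) (r (fst (\<sigma> (t, i)))) (\<omega> (t, i))) = pi"
    by blast
  define w where "w s = base_tan (r (fst s)) (r (fst (\<sigma> s))) (\<omega> s)" for s
  have fst_T: "fst s \<in> T" "fst (\<sigma> s) \<in> T" if "s \<in> slots T" for s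
    using that \<sigma>T(1)[OF that] by (auto simp: slots_def)
  have w: "arctan (w s) + arctan (w (\<sigma> s)) = \<omega> s"
    "(sinh (r (fst s)))\<^sup>2 / (1 + (cosh (r (fst s)) * w s)\<^sup>2)
      = (sinh (r (fst (\<sigma> s))))\<^sup>2 / (1 + (cosh (r (fst (\<sigma> s))) * w (\<sigma> s))\<^sup>2)"
    if s: "s \<in> slots T" for s
    using base_angles_sum[of "r (fst s)" "r (fst (\<sigma> s))" "\<omega> s"]
      common_chord[of "r (fst s)" "r (fst (\<sigma> s))" "\<omega> s"] r(1) fst_T[OF s] \<omega>[OF s] \<sigma>\<sigma>[OF s]
    by (simp_all add: w_def)
  show ?thesis
  proof (intro exI conjI ballI)
    show "0 < r t" if "t \<in> T" for t using r(1) that .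
    show "(\<Sum>i\<in>UNIV. pi / 2 - arctan (cosh (r t) * w (t, i))) = pi" if "t \<in> T" for t
      using r(2)[OF that] by (simp add: half_central_angle_def w_def)
  next
    fix e assume "e \<in> edges T \<phi>"
    then obtain s where s: "s \<in> slots T" "e = edge_at \<phi> s" unfolding edges_def by blast
    have sd: "sides_of T \<phi> e = {s, \<sigma> s}" using \<sigma>(1) s by simp
    show "(\<Sum>s\<in>sides_of T \<phi> e. arctan (w s)) = p e"
      using w(1)[OF s(1)] \<sigma>(2)[OF s(1)] unfolding sd
      by (cases "\<sigma> s = s") (simp_all add: \<omega>_def s(2))
    fix a b assume "a \<in> sides_of T \<phi> e" "b \<in> sides_of T \<phi> e"
    then show "(sinh (r (fst a)))\<^sup>2 / (1 + (cosh (r (fst a)) * w a)\<^sup>2)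
         = (sinh (r (fst b)))\<^sup>2 / (1 + (cosh (r (fst b)) * w b)\<^sup>2)"
      unfolding sd using w(2)[OF s(1)] by auto
  qed
qed

theorem theorem2:
  fixes M :: "'m::t2_space set"
    and U :: "'u::topological_space set"
    and q :: "'u \<Rightarrow> 'm"
    and T :: "'t set"
    and \<phi> :: "'t \<Rightarrow> real ^ 3 \<Rightarrow> 'm"
    and p :: "'m set \<Rightarrow> real"
  assumes "compact_surface M"
    and "triangular_decomposition M U q T \<phi>"
    and "euler_characteristic T \<phi> < 0"
    and "\<And>e. e \<in> edges T \<phi> - boundary_edges M T \<phi> \<Longrightarrow> 0 < p e \<and> p e < pi"
    and "\<And>e. e \<in> boundary_edges M T \<phi> \<Longrightarrow> 0 < p e \<and> p e < pi / 2"
    and "\<And>v. v \<in> vertices T \<phi> - boundary_vertices M T \<phi> \<Longrightarrow>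
           (\<Sum>e\<in>edges T \<phi>. real (end_mult v e) * p e) = 2 * pi"
    and "\<And>v. v \<in> boundary_vertices M T \<phi> \<Longrightarrow>
           (\<Sum>e\<in>edges T \<phi>. real (end_mult v e) * p e) = pi"
    and "\<And>S. S \<subseteq> T \<Longrightarrow> S \<noteq> {} \<Longrightarrow>
           (\<Sum>e\<in>edges S \<phi>. theta M T \<phi> p e) > pi * real (card S)"
  shows "ideal_disk_pattern M T \<phi> p"
proof -
  have cd: "cell_decomposition M T \<phi>"
    using assms(2) by (simp add: triangular_decomposition_def)
  have interior: "\<forall>e\<in>edges T \<phi> - boundary_edges M T \<phi>. 0 < p e \<and> p e < pi"
    and boundary: "\<forall>e\<in>boundary_edges M T \<phi>. 0 < p e \<and> p e < pi / 2"
    and hall: "\<forall>S. S \<subseteq> T \<longrightarrow> S \<noteq> {} \<longrightarrow>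
           (\<Sum>e\<in>edges S \<phi>. theta M T \<phi> p e) > pi * real (card S)"
    using assms(4,5,8) by blast+
  obtain r w where r: "\<And>t. t \<in> T \<Longrightarrow> 0 < r t"
    and centre: "\<And>t. t \<in> T \<Longrightarrow> (\<Sum>i\<in>UNIV. pi / 2 - arctan (cosh (r t) * w (t, i))) = pi"
    and base: "\<And>e. e \<in> edges T \<phi> \<Longrightarrow> (\<Sum>s\<in>sides_of T \<phi> e. arctan (w s)) = p e"
    and chord: "\<And>e s s'. e \<in> edges T \<phi> \<Longrightarrow> s \<in> sides_of T \<phi> e \<Longrightarrow> s' \<in> sides_of T \<phi> e \<Longrightarrow>
           (sinh (r (fst s)))\<^sup>2 / (1 + (cosh (r (fst s)) * w s)\<^sup>2)
         = (sinh (r (fst s')))\<^sup>2 / (1 + (cosh (r (fst s')) * w s')\<^sup>2)"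
  proof -
    obtain r w where rw:
      "\<forall>t\<in>T. 0 < r t \<and> (\<Sum>i\<in>UNIV. pi / 2 - arctan (cosh (r t) * w (t, i))) = pi"
      "\<forall>e\<in>edges T \<phi>. (\<Sum>s\<in>sides_of T \<phi> e. arctan (w s)) = p e \<and>
        (\<forall>s\<in>sides_of T \<phi> e. \<forall>s'\<in>sides_of T \<phi> e.
           (sinh (r (fst s)))\<^sup>2 / (1 + (cosh (r (fst s)) * w s)\<^sup>2)
             = (sinh (r (fst s')))\<^sup>2 / (1 + (cosh (r (fst s')) * w s')\<^sup>2))"
      using circle_pattern_exists[OF cd interior boundary hall] by (elim exE conjE)
    show thesis by (rule that[of r w]) (use rw in blast)+
  qed
  \<comment> \<open>The angle at a corner is the sum of the base angles of the two sides meeting there.\<close>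
  define u where "u s = arctan (w (fst s, snd s + 1)) + arctan (w (fst s, snd s + 2))" for s
  have side: "side_psi u s = arctan (w s)" for s
    by (cases s) (simp only: side_psi_def u_def prod.case fst_conv snd_conv cyclic_3_add, simp)
  have Psi: "Psi T \<phi> u e = p e" if "e \<in> edges T \<phi>" for e
    using base[OF that] by (simp add: Psi_def side)
  have centre3: "(pi / 2 - arctan (cosh (r t) * w (t, i))) + (pi / 2 - arctan (cosh (r t) * w (t, i + 1)))
      + (pi / 2 - arctan (cosh (r t) * w (t, i + 2))) = pi" if "t \<in> T" for t i
    using centre[OF that] unfolding sum_3_cyclic[of _ i] .
  note tri = inscribed_triangle[OF r centre3]
  have vertex: "vertex_angle_sum T \<phi> v u = (\<Sum>e\<in>edges T \<phi>. real (end_mult v e) * p e)" for v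
    unfolding vertex_angle_sum_eq[OF cd] using Psi by (intro sum.cong) auto
  have pos: "0 < u s \<and> u s < pi" if "s \<in> slots T" for s
  proof -
    obtain t i where s: "s = (t, i)" "t \<in> T" using \<open>s \<in> slots T\<close> by (auto simp: slots_def)
    have "0 < u s"
      using tri(1)[OF s(2) s(2), of "i + 1"] unfolding u_def s(1) fst_conv snd_conv cyclic_3_add .
    moreover have "u s < pi"
      using arctan[of "w (t, i + 1)"] arctan[of "w (t, i + 2)"] unfolding u_def s(1) fst_conv snd_conv
      by linarith
    ultimately show ?thesis by simp
  qed
  have curv: "triangle_curvature t u < 0" if "t \<in> T" for t
  proof -
    fix i :: 3
    have "triangle_angle_sum t u = 2 * (arctan (w (t, i)) + arctan (w (t, i + 1)) + arctan (w (t, i + 2)))"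
      unfolding triangle_angle_sum_def sum_3_cyclic[of _ i] u_def fst_conv snd_conv cyclic_3_add
      by simp
    then show ?thesis
      using tri(2)[OF that that, of i] by (simp add: triangle_curvature_def)
  qed
  have len: "side_length u s
      = arcosh (1 + 2 * ((sinh (r (fst s)))\<^sup>2 / (1 + (cosh (r (fst s)) * w s)\<^sup>2)))" if "s \<in> slots T" for s
  proof -
    obtain t i where s: "s = (t, i)" "t \<in> T" using \<open>s \<in> slots T\<close> by (auto simp: slots_def)
    show ?thesis
      using tri(3)[OF s(2) s(2), of i]
      unfolding s(1) side_length_def u_def prod.case fst_conv snd_conv cyclic_3_add by simp
  qed
  have "u \<in> angle_systems M T \<phi>"
    using pos curv vertex assms(6,7) by (simp add: angle_systems_def vertex_flat_systems_def)
  moreover have "side_length u s = side_length u s'"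
    if "e \<in> edges T \<phi>" "s \<in> sides_of T \<phi> e" "s' \<in> sides_of T \<phi> e" for e s s'
    using that len[of s] len[of s'] chord[OF that] by (simp add: sides_of_def)
  ultimately have "uniform M T \<phi> u" unfolding uniform_def by blast
  then show ?thesis using Psi by (auto simp: ideal_disk_pattern_def)
qed

end
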